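(* For $k\ge i\ge1$, \[ \sum_{N_1\ge\cdots\ge N_{k-1}\ge0}\frac{(-q^{2-2N_1};q^2)_{N_1-1}(-q^{1-2N_1};q^2)_{N_1}\,q^{2(N_1^2+\cdots+N_{k-1}^2+N_{i+1}+\cdots+N_{k-1})}(1+q^{2N_i})}{(q^2;q^2)_{N_1-N_2}\cdots(q^2;q^2)_{N_{k-2}-N_{k-1}}(q^2;q^2)_{N_{k-1}}} =\frac{(-q;q)_\infty\,(q^{2i-1},q^{4k-1-2i},q^{4k-2};q^{4k-2})_\infty}{(q;q)_\infty}. \]
   Context: $(a;q)_\infty=\prod_{j\ge0}(1-aq^j)$, $(a;q)_n=(a;q)_\infty/(aq^n;q)_\infty$ for every integer $n$, and $(a_1,\dots,a_m;q)_\infty=(a_1;q)_\infty\cdots(a_m;q)_\infty$. The sum runs over integer tuples $(N_1,\dots,N_{k-1})$ with $N_1\ge\cdots\ge N_{k-1}\ge0$; empty sums are $0$, and in the case $i=k$ one sets $N_k=0$. *)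

theory Defs
  imports "HOL-Analysis.Analysis"
begin

definition qpoch_inf :: "complex \<Rightarrow> complex \<Rightarrow> complex" where
  "qpoch_inf a q = (\<Prod>j. 1 - a * q ^ j)"

definition qpoch :: "complex \<Rightarrow> complex \<Rightarrow> int \<Rightarrow> complex" where
  "qpoch a q n = qpoch_inf a q / qpoch_inf (a * q powi n) q"

definition qpochs_inf :: "complex list \<Rightarrow> complex \<Rightarrow> complex" where
  "qpochs_inf as q = (\<Prod>a\<leftarrow>as. qpoch_inf a q)"

text \<open>
  A tuple \<open>(N\<^sub>1, \<dots>, N\<^sub>k\<^sub>-\<^sub>1)\<close> is a function on the indices \<open>1, \<dots>, k - 1\<close>, extended by \<open>0\<close> to all
  other indices. Each tuple thus has exactly one representative, and the convention \<open>N\<^sub>k = 0\<close>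
  is built in.
\<close>

definition tuples :: "nat \<Rightarrow> (nat \<Rightarrow> int) set" where
  "tuples k = {N. (\<forall>j\<in>{1..<k}. 0 \<le> N j) \<and>
                  (\<forall>j. 1 \<le> j \<and> j + 1 < k \<longrightarrow> N (j + 1) \<le> N j) \<and>
                  (\<forall>j. j \<notin> {1..<k} \<longrightarrow> N j = 0)}"

text \<open>
  For \<open>k = 1\<close> the denominator is an empty product; below, its last factor is then
  \<open>qpoch (q\<^sup>2) (q\<^sup>2) (N 0) = 1\<close>, because \<open>N 0 = 0\<close>.
\<close>

definition summand :: "nat \<Rightarrow> nat \<Rightarrow> complex \<Rightarrow> (nat \<Rightarrow> int) \<Rightarrow> complex" where
  "summand k i q N =
     qpoch (- (q powi (2 - 2 * N 1))) (q\<^sup>2) (N 1 - 1) *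
     qpoch (- (q powi (1 - 2 * N 1))) (q\<^sup>2) (N 1) *
     q powi (2 * ((\<Sum>j\<in>{1..<k}. (N j)\<^sup>2) + (\<Sum>j\<in>{i+1..<k}. N j))) *
     (1 + q powi (2 * N i)) /
     ((\<Prod>j\<in>{1..<k-1}. qpoch (q\<^sup>2) (q\<^sup>2) (N j - N (j + 1))) * qpoch (q\<^sup>2) (q\<^sup>2) (N (k - 1)))"

end

theory Submission
  imports Defs
begin

text \<open>
  Iterate Bailey's lemma in base \<open>p = q\<^sup>2\<close>, starting from the innermost index. From the unit Bailey
  pair relative to \<open>a = p\<close>, a case of the finite triple product, the indices
  \<open>N\<^sub>k = 0, N\<^sub>k\<^sub>-\<^sub>1, \<dots>, N\<^sub>i\<^sub>+\<^sub>1\<close> multiply the coefficient \<open>\<alpha>\<^sub>s = (-1)\<^sup>s p\<^bsup>s(s-1)/2\<^esup>\<close>, \<open>s \<in> \<int>\<close>, by a factor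
  \<open>p\<^bsup>s(s+1)\<^esup>\<close> each. The reflection \<open>s \<mapsto> -1-s\<close> shows that the factor \<open>1 + p\<^bsup>N i\<^esup>\<close> turns this into a pair
  relative to \<open>a = 1\<close> with coefficients \<open>(1 + p\<^sup>s) \<alpha>\<^sub>s\<close>; the indices \<open>N\<^sub>i, \<dots>, N\<^sub>2\<close> then contribute a
  factor \<open>p\<^bsup>s*s\<^esup>\<close> each. After an exchange of summations, the sum over \<open>N\<^sub>1\<close> is an instance of the
  \<open>q\<close>-Gauss sum and equals \<open>(-q;q)\<^sub>\<infinity> / (q;q)\<^sub>\<infinity> * q\<^sup>s / (1 + p\<^sup>s)\<close>, which cancels \<open>1 + p\<^sup>s\<close>. What remains
  is a theta series, evaluated by Jacobi's triple product.
\<close>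

section \<open>Infinite sums\<close>

lemma summable_on_dominated:
  fixes f :: "'a \<Rightarrow> 'c :: banach" and h :: "'a \<Rightarrow> real"
  assumes "h summable_on A" and "\<And>x. x \<in> A \<Longrightarrow> norm (f x) \<le> h x"
  shows "f summable_on A"
  by (rule abs_summable_summable[OF Infinite_Sum.abs_summable_on_comparison_test'[OF assms]])

lemma has_sum_tannery:
  fixes f :: "'b \<Rightarrow> 'a \<Rightarrow> 'c :: banach" and h :: "'a \<Rightarrow> real"
  assumes bound: "\<And>n x. x \<in> A \<Longrightarrow> norm (f n x) \<le> h x"
    and h_summable: "h summable_on A"
    and lim: "\<And>x. x \<in> A \<Longrightarrow> ((\<lambda>n. f n x) \<longlongrightarrow> g x) F"
    and sums: "\<And>n. (f n has_sum S n) A"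
    and "F \<noteq> bot" and S_tendsto: "(S \<longlongrightarrow> T) F"
  shows "(g has_sum T) A"
proof -
  have "norm (g x) \<le> h x" if "x \<in> A" for x
    by (rule tendsto_upperbound[OF tendsto_norm[OF lim[OF that]]])
       (use bound[OF that] \<open>F \<noteq> bot\<close> in auto)
  hence g_summable: "g summable_on A" by (rule summable_on_dominated[OF h_summable])
  have "(S \<longlongrightarrow> infsum g A) F"
  proof (rule swap_uniform_limit')
    show "(sum g \<longlongrightarrow> infsum g A) (finite_subsets_at_top A)"
      using g_summable by (rule infsum_tendsto)
    show "\<forall>\<^sub>F X in finite_subsets_at_top A. ((\<lambda>n. \<Sum>x\<in>X. f n x) \<longlongrightarrow> sum g X) F"
      using lim by (intro eventually_finite_subsets_at_top_weakI tendsto_sum) auto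
    show "uniform_limit UNIV (\<lambda>X n. \<Sum>x\<in>X. f n x) S (finite_subsets_at_top A)"
      by (rule Weierstrass_m_test_general'[OF _ sums h_summable]) (use bound in auto)
  qed auto
  hence "T = infsum g A"
    using S_tendsto \<open>F \<noteq> bot\<close> tendsto_unique by blast
  thus ?thesis using g_summable by simp
qed

lemma summable_on_product:
  fixes g :: "'a \<Rightarrow> real" and h :: "'b \<Rightarrow> real"
  assumes g_summable: "g summable_on A" and h_summable: "h summable_on B"
    and nonneg: "\<And>x. x \<in> A \<Longrightarrow> 0 \<le> g x" "\<And>y. y \<in> B \<Longrightarrow> 0 \<le> h y"
  shows "(\<lambda>(x, y). g x * h y) summable_on A \<times> B"
proof (rule summable_on_SigmaI)
  show "((\<lambda>y. case (x, y) of (x, y) \<Rightarrow> g x * h y) has_sum g x * infsum h B) B" for x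
    using h_summable by (auto intro: has_sum_cmult_right)
  show "(\<lambda>x. g x * infsum h B) summable_on A"
    using g_summable by (rule summable_on_cmult_left)
qed (use nonneg in auto)

lemma has_sum_exchange:
  fixes f :: "'a \<Rightarrow> 'b \<Rightarrow> 'c :: banach"
    and g :: "'a \<Rightarrow> 'd :: real_normed_vector" and h :: "'b \<Rightarrow> 'e :: real_normed_vector"
  assumes g_summable: "(\<lambda>x. norm (g x)) summable_on A" and h_summable: "(\<lambda>y. norm (h y)) summable_on B"
    and bound: "\<And>x y. x \<in> A \<Longrightarrow> y \<in> B \<Longrightarrow> norm (f x y) \<le> norm (g x) * norm (h y)"
    and rows: "\<And>x. x \<in> A \<Longrightarrow> (f x has_sum r x) B"
    and columns: "\<And>y. y \<in> B \<Longrightarrow> ((\<lambda>x. f x y) has_sum c y) A"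
    and total: "(c has_sum S) B"
  shows "(r has_sum S) A"
proof -
  have "(\<lambda>(x, y). norm (g x) * norm (h y)) summable_on A \<times> B"
    using g_summable h_summable by (rule summable_on_product) auto
  hence f_summable: "(\<lambda>(x, y). f x y) summable_on A \<times> B"
    by (rule summable_on_dominated) (use bound in auto)
  have infsum_row: "infsum (f x) B = r x" if "x \<in> A" for x
    using rows[OF that] by (rule infsumI)
  have "(\<lambda>x. infsum (f x) B) summable_on A"
    using f_summable by (rule summable_on_Sigma_banach)
  hence "r summable_on A"
    by (rule summable_on_cong[THEN iffD1, rotated]) (rule infsum_row)
  moreover have "infsum r A = S"
  proof -
    have "infsum r A = (\<Sum>\<^sub>\<infinity>x\<in>A. \<Sum>\<^sub>\<infinity>y\<in>B. f x y)"
      by (intro infsum_cong) (simp add: infsum_row)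
    also have "\<dots> = (\<Sum>\<^sub>\<infinity>y\<in>B. \<Sum>\<^sub>\<infinity>x\<in>A. f x y)"
      using f_summable by (rule infsum_swap_banach)
    also have "\<dots> = infsum c B"
      using columns by (intro infsum_cong infsumI) auto
    finally show ?thesis using total by (simp add: infsumI)
  qed
  ultimately show ?thesis by (simp add: has_sum_iff)
qed

lemma tendsto_imp_norm_bounded:
  fixes X :: "nat \<Rightarrow> 'a :: real_normed_vector"
  assumes "X \<longlonglongrightarrow> L"
  obtains C where "C > 0" and "\<And>n. norm (X n) \<le> C"
  using assms convergent_imp_Bseq[of X] by (auto simp: convergent_def Bseq_def)

lemma has_sum_sum:
  fixes f :: "'b \<Rightarrow> 'a \<Rightarrow> 'c :: topological_comm_monoid_add"
  assumes "finite I" and "\<And>r. r \<in> I \<Longrightarrow> (f r has_sum b r) A"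
  shows "((\<lambda>x. \<Sum>r\<in>I. f r x) has_sum (\<Sum>r\<in>I. b r)) A"
  using assms by (induction I rule: finite_induct) (auto intro!: has_sum_add)

lemma has_sum_int_shift:
  fixes f :: "int \<Rightarrow> 'a :: {comm_monoid_add, topological_space}"
  shows "((\<lambda>s. f (s + a)) has_sum S) UNIV \<longleftrightarrow> (f has_sum S) UNIV"
  by (rule has_sum_reindex_bij_witness[of _ "\<lambda>s. s - a" "\<lambda>s. s + a"]) auto

lemma has_sum_int_reflect:
  fixes f :: "int \<Rightarrow> 'a :: {comm_monoid_add, topological_space}"
  shows "((\<lambda>s. f (a - s)) has_sum S) UNIV \<longleftrightarrow> (f has_sum S) UNIV"
  by (rule has_sum_reindex_bij_witness[of _ "\<lambda>s. a - s" "\<lambda>s. a - s"]) auto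

lemma has_sum_int_antisymmetric:
  fixes f :: "int \<Rightarrow> 'a :: real_normed_vector"
  assumes f_has_sum: "(f has_sum S) UNIV" and antisymmetric: "\<And>s. f (a - s) = - f s"
  shows "S = 0"
proof -
  have "((\<lambda>s. f (a - s)) has_sum S) UNIV"
    using f_has_sum by (subst has_sum_int_reflect)
  hence "(f has_sum - S) UNIV"
    by (simp add: antisymmetric has_sum_uminus)
  hence "S = - S" using f_has_sum has_sum_unique by blast
  hence "2 *\<^sub>R S = 0" by (metis add.left_inverse scaleR_2)
  thus ?thesis by simp
qed

lemma summable_ratio_tendsto:
  fixes f :: "nat \<Rightarrow> 'a :: banach" and \<rho> :: "nat \<Rightarrow> real"
  assumes ratio: "\<And>n. norm (f (Suc n)) \<le> \<rho> n * norm (f n)"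
    and "\<rho> \<longlonglongrightarrow> l" and "l < 1"
  shows "summable f"
proof -
  obtain c where "l < c" "c < 1" using \<open>l < 1\<close> dense by blast
  have "eventually (\<lambda>n. \<rho> n < c) sequentially"
    using \<open>\<rho> \<longlonglongrightarrow> l\<close> \<open>l < c\<close> by (rule order_tendstoD)
  then obtain N where N: "\<And>n. n \<ge> N \<Longrightarrow> \<rho> n < c"
    by (auto simp: eventually_sequentially)
  show ?thesis
  proof (rule summable_ratio_test[OF \<open>c < 1\<close>])
    fix n assume "n \<ge> N"
    hence "\<rho> n * norm (f n) \<le> c * norm (f n)"
      using N[of n] by (intro mult_right_mono) auto
    thus "norm (f (Suc n)) \<le> c * norm (f n)" using ratio[of n] by linarith
  qed
qed

lemma summable_poly_geometric:
  fixes r :: real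
  assumes "0 \<le> r" and "r < 1"
  shows "summable (\<lambda>n. real (Suc n) ^ m * r ^ n)"
proof (rule summable_ratio_tendsto)
  show "(\<lambda>n. (1 + inverse (real (Suc n))) ^ m * r) \<longlonglongrightarrow> (1 + 0) ^ m * r"
    by (intro tendsto_intros LIMSEQ_inverse_real_of_nat)
  show "norm (real (Suc (Suc n)) ^ m * r ^ Suc n)
      \<le> (1 + inverse (real (Suc n))) ^ m * r * norm (real (Suc n) ^ m * r ^ n)" for n
  proof -
    have "real (Suc (Suc n)) = (1 + inverse (real (Suc n))) * real (Suc n)"
      by (simp add: field_simps)
    hence "real (Suc (Suc n)) ^ m = (1 + inverse (real (Suc n))) ^ m * real (Suc n) ^ m"
      by (simp only: power_mult_distrib)
    thus ?thesis using \<open>0 \<le> r\<close> by (simp add: abs_mult)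
  qed
qed (use \<open>r < 1\<close> in simp)

section \<open>Shifted factorials\<close>

definition qpochhammer :: "'a :: comm_ring_1 \<Rightarrow> 'a \<Rightarrow> nat \<Rightarrow> 'a" where
  "qpochhammer a q n = (\<Prod>j<n. 1 - a * q ^ j)"

lemma qpochhammer_0 [simp]: "qpochhammer a q 0 = 1"
  by (simp add: qpochhammer_def)

lemma qpochhammer_Suc: "qpochhammer a q (Suc n) = qpochhammer a q n * (1 - a * q ^ n)"
  by (simp add: qpochhammer_def)

lemma qpochhammer_add: "qpochhammer a q (m + n) = qpochhammer a q m * qpochhammer (a * q ^ m) q n"
  by (induction n) (simp_all add: qpochhammer_Suc power_add mult.assoc)

lemma qpochhammer_Suc_left: "qpochhammer a q (Suc n) = (1 - a) * qpochhammer (a * q) q n"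
  using qpochhammer_add[of a q 1 n] by (simp add: qpochhammer_Suc)

definition tri :: "int \<Rightarrow> int" where
  "tri s = s * (s - 1) div 2"

lemma two_tri: "2 * tri s = s * (s - 1)"
  by (simp add: tri_def)

lemma tri_add: "tri (s + t) = tri s + tri t + s * t"
  using two_tri[of "s + t"] two_tri[of s] two_tri[of t] by (simp add: algebra_simps)

lemma tri_reflect: "tri (1 - s) = tri s"
  by (simp add: tri_def algebra_simps)

lemma tri_0 [simp]: "tri 0 = 0"
  and tri_1 [simp]: "tri 1 = 0"
  by (simp_all add: tri_def)

lemma qpochhammer_reverse:
  fixes a q :: "'a :: field"
  assumes "a \<noteq> 0" and "q \<noteq> 0"
  shows "qpochhammer a q n = (- a) ^ n * q powi tri (int n) * qpochhammer (q powi (1 - int n) / a) q n"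
proof -
  have "qpochhammer (q powi (1 - int n) / a) q n = (\<Prod>j<n. 1 - inverse (a * q ^ (n - Suc j)))"
    unfolding qpochhammer_def
  proof (intro prod.cong refl)
    fix j assume "j \<in> {..<n}"
    hence "1 - int n + int j = - int (n - Suc j)" by auto
    hence "q powi (1 - int n) * q ^ j = inverse (q ^ (n - Suc j))"
      using assms by (metis power_int_add power_int_minus power_int_of_nat)
    thus "1 - q powi (1 - int n) / a * q ^ j = 1 - inverse (a * q ^ (n - Suc j))"
      by (simp add: field_simps)
  qed
  also have "\<dots> = (\<Prod>j<n. 1 - inverse (a * q ^ j))"
    by (rule prod.nat_diff_reindex)
  finally have "qpochhammer (q powi (1 - int n) / a) q n = (\<Prod>j<n. 1 - inverse (a * q ^ j))" .
  moreover have "qpochhammer a q n = (- a) ^ n * q powi tri (int n) * (\<Prod>j<n. 1 - inverse (a * q ^ j))"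
  proof (induction n)
    case (Suc n)
    have "q powi tri (int (Suc n)) = q powi tri (int n) * q ^ n"
      using assms by (simp add: tri_add power_int_add)
    moreover have "1 - a * q ^ n = - a * q ^ n * (1 - inverse (a * q ^ n))"
      using assms by (simp add: field_simps)
    ultimately show ?case by (simp add: qpochhammer_Suc Suc.IH mult_ac)
  qed simp
  ultimately show ?thesis by simp
qed

lemma norm_mult_power_less_1:
  fixes z q :: "'a :: real_normed_div_algebra"
  assumes "norm z < 1" and "norm q < 1"
  shows "norm (z * q ^ n) < 1"
proof -
  have "norm z * norm q ^ n \<le> norm z"
    using assms by (intro mult_left_le power_le_one) auto
  thus ?thesis using assms by (simp add: norm_mult norm_power)
qed

lemma convergent_prod_qpoch_inf:
  fixes a q :: complex
  assumes "norm q < 1"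
  shows "convergent_prod (\<lambda>j. 1 - a * q ^ j)"
proof -
  have "summable (\<lambda>j. norm a * norm q ^ j)"
    using assms by (intro summable_mult summable_geometric) auto
  hence "abs_convergent_prod (\<lambda>j. 1 - a * q ^ j)"
    by (simp add: abs_convergent_prod_conv_summable norm_mult norm_power)
  thus ?thesis by (rule abs_convergent_prod_imp_convergent_prod)
qed

lemma qpochhammer_tendsto:
  assumes "norm q < 1"
  shows "qpochhammer a q \<longlonglongrightarrow> qpoch_inf a q"
proof -
  have "(\<lambda>n. \<Prod>j\<le>n. 1 - a * q ^ j) \<longlonglongrightarrow> qpoch_inf a q"
    unfolding qpoch_inf_def by (intro convergent_prod_LIMSEQ convergent_prod_qpoch_inf assms)
  hence "(\<lambda>n. qpochhammer a q (Suc n)) \<longlonglongrightarrow> qpoch_inf a q"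
    by (simp add: qpochhammer_def lessThan_Suc_atMost)
  thus ?thesis by (rule LIMSEQ_imp_Suc)
qed

lemma qpoch_inf_split:
  assumes "norm q < 1"
  shows "qpoch_inf a q = qpochhammer a q n * qpoch_inf (a * q ^ n) q"
proof (rule LIMSEQ_unique)
  show "(\<lambda>m. qpochhammer a q (m + n)) \<longlonglongrightarrow> qpoch_inf a q"
    by (rule LIMSEQ_ignore_initial_segment[OF qpochhammer_tendsto[OF assms]])
  show "(\<lambda>m. qpochhammer a q (m + n)) \<longlonglongrightarrow> qpochhammer a q n * qpoch_inf (a * q ^ n) q"
    unfolding add.commute[of _ n] qpochhammer_add
    by (intro tendsto_mult tendsto_const qpochhammer_tendsto assms)
qed

lemma qpoch_inf_nonzero:
  assumes "norm q < 1" and "norm a < 1"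
  shows "qpoch_inf a q \<noteq> 0"
proof -
  have "norm (a * q ^ j) < 1" for j
    using assms by (intro norm_mult_power_less_1)
  hence "1 - a * q ^ j \<noteq> 0" for j
    by (metis norm_one order_less_irrefl right_minus_eq)
  thus ?thesis
    unfolding qpoch_inf_def by (intro prodinf_nonzero convergent_prod_qpoch_inf assms)
qed

lemma qpoch_inf_even_odd:
  assumes "norm q < 1"
  shows "qpoch_inf a (q\<^sup>2) * qpoch_inf (a * q) (q\<^sup>2) = qpoch_inf a q"
proof (rule LIMSEQ_unique)
  have "norm (q\<^sup>2) < 1"
    using assms by (simp add: norm_power power_less_one_iff)
  thus "(\<lambda>n. qpochhammer a (q\<^sup>2) n * qpochhammer (a * q) (q\<^sup>2) n)
      \<longlonglongrightarrow> qpoch_inf a (q\<^sup>2) * qpoch_inf (a * q) (q\<^sup>2)"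
    by (intro tendsto_mult qpochhammer_tendsto)
  have "(\<lambda>n. qpochhammer a q (2 * n)) \<longlonglongrightarrow> qpoch_inf a q"
    using LIMSEQ_subseq_LIMSEQ[OF qpochhammer_tendsto[OF assms, of a], of "\<lambda>n. 2 * n"]
    by (auto simp: strict_mono_def o_def)
  moreover have "qpochhammer a q (2 * n) = qpochhammer a (q\<^sup>2) n * qpochhammer (a * q) (q\<^sup>2) n" for n
    by (induction n) (auto simp: qpochhammer_Suc power_mult[symmetric] mult_ac)
  ultimately show "(\<lambda>n. qpochhammer a (q\<^sup>2) n * qpochhammer (a * q) (q\<^sup>2) n) \<longlonglongrightarrow> qpoch_inf a q"
    by simp
qed

lemma qpoch_of_nat:
  assumes "norm q < 1" and "qpoch_inf (a * q ^ n) q \<noteq> 0"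
  shows "qpoch a q (int n) = qpochhammer a q n"
  using assms qpoch_inf_split[of q a n] by (simp add: qpoch_def)

section \<open>The \<open>q\<close>-binomial theorem and the \<open>q\<close>-Gauss sum\<close>

locale q_base =
  fixes q :: complex
  assumes q_nonzero [simp]: "q \<noteq> 0" and norm_q_less_1: "norm q < 1"
begin

lemma powi_add: "q powi (a + b) = q powi a * q powi b"
  by (simp add: power_int_add)

lemma power_neq_1: "n > 0 \<Longrightarrow> q ^ n \<noteq> 1"
  using norm_q_less_1 power_eq_1_iff[of q n] by auto

lemma powi_sum: "finite A \<Longrightarrow> q powi (\<Sum>x\<in>A. f x) = (\<Prod>x\<in>A. q powi f x)"
  by (induction A rule: finite_induct) (auto simp: powi_add)

lemma norm_powi_le_1: "s \<ge> 0 \<Longrightarrow> norm (q powi s) \<le> 1"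
  using norm_q_less_1 by (simp add: power_int_def norm_power power_le_one)

lemma one_plus_powi_nonzero: "1 + q powi s \<noteq> 0"
proof
  assume "1 + q powi s = 0"
  hence "norm (q powi s) = 1" by (simp add: add_eq_0_iff)
  hence "norm q ^ nat \<bar>s\<bar> = 1"
    by (auto simp: power_int_def norm_power norm_inverse power_inverse split: if_splits)
  hence "s = 0"
    using power_eq_1_iff[of "norm q" "nat \<bar>s\<bar>"] norm_q_less_1 by auto
  thus False using \<open>1 + q powi s = 0\<close> by simp
qed

text \<open>
  The value \<open>0\<close> for \<open>n < 0\<close> lets finite sums range over all integers, so that shifts and
  reflections of the index cost nothing.
\<close>

definition rqfac :: "int \<Rightarrow> complex" where
  "rqfac n = (if n < 0 then 0 else inverse (qpochhammer q q (nat n)))"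

lemma rqfac_neg [simp]: "n < 0 \<Longrightarrow> rqfac n = 0"
  by (simp add: rqfac_def)

lemma rqfac_of_nat: "rqfac (int n) = inverse (qpochhammer q q n)"
  by (simp add: rqfac_def)

lemma rqfac_0 [simp]: "rqfac 0 = 1"
  by (simp add: rqfac_def)

lemma qpochhammer_q_nonzero: "qpochhammer q q n \<noteq> 0"
  unfolding qpochhammer_def using power_neq_1[of "Suc _"] by (simp flip: power_Suc)

lemma rqfac_diff_1: "rqfac (n - 1) = (1 - q powi n) * rqfac n"
proof -
  consider (neg) "n < 0" | (zero) "n = 0" | (pos) m where "n = int (Suc m)"
    by (metis not0_implies_Suc nonneg_int_cases not_less of_nat_0)
  thus ?thesis
  proof cases
    case (pos m)
    have "qpochhammer q q (Suc m) = qpochhammer q q m * (1 - q powi n)"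
      unfolding pos power_int_of_nat by (simp add: qpochhammer_Suc)
    moreover have "n - 1 = int m" using pos by simp
    ultimately show ?thesis
      using qpochhammer_q_nonzero[of "Suc m"] pos by (simp only: rqfac_of_nat) (simp add: field_simps)
  qed auto
qed

lemma rqfac_conv_add_1: "rqfac n = (1 - q powi (n + 1)) * rqfac (n + 1)"
  using rqfac_diff_1[of "n + 1"] by simp

lemma rqfac_Suc: "rqfac (int n) = (1 - q ^ Suc n) * rqfac (int (Suc n))"
  using rqfac_diff_1[of "int (Suc n)"] by (simp only: power_int_of_nat) simp

lemma qpoch_q_q:
  assumes "0 \<le> m"
  shows "qpoch q q m = inverse (rqfac m)"
proof -
  obtain n where m: "m = int n" using assms by (metis nonneg_int_cases)
  have "qpoch_inf (q * q ^ n) q \<noteq> 0"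
    by (intro qpoch_inf_nonzero norm_mult_power_less_1 norm_q_less_1)
  thus ?thesis
    by (simp add: m qpoch_of_nat norm_q_less_1 rqfac_of_nat)
qed

lemma qpoch_inf_q_nonzero: "qpoch_inf q q \<noteq> 0"
  using norm_q_less_1 by (rule qpoch_inf_nonzero) (rule norm_q_less_1)

lemma rqfac_tendsto: "(\<lambda>n. rqfac (int n + a)) \<longlonglongrightarrow> 1 / qpoch_inf q q"
proof (rule Lim_transform_eventually)
  have "filterlim (\<lambda>n. nat (int n + a)) sequentially sequentially"
  proof (rule filterlim_at_top_mono)
    show "filterlim (\<lambda>n. n - nat \<bar>a\<bar>) sequentially sequentially"
      by (rule filterlim_minus_const_nat_at_top)
    show "\<forall>\<^sub>F n in sequentially. n - nat \<bar>a\<bar> \<le> nat (int n + a)"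
      by (intro always_eventually allI) linarith
  qed
  from filterlim_compose[OF qpochhammer_tendsto[OF norm_q_less_1] this]
  show "(\<lambda>n. 1 / qpochhammer q q (nat (int n + a))) \<longlonglongrightarrow> 1 / qpoch_inf q q"
    by (intro tendsto_divide tendsto_const qpoch_inf_q_nonzero)
  show "\<forall>\<^sub>F n in sequentially. 1 / qpochhammer q q (nat (int n + a)) = rqfac (int n + a)"
    using eventually_ge_at_top[of "nat \<bar>a\<bar>"]
    by eventually_elim (simp add: rqfac_def inverse_eq_divide)
qed

lemma rqfac_bounded:
  obtains C where "C \<ge> 1" and "\<And>n. norm (rqfac n) \<le> C"
proof -
  obtain C where C: "C > 0" "\<And>n. norm (rqfac (int n)) \<le> C"
    using tendsto_imp_norm_bounded[OF rqfac_tendsto[of 0]] by auto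
  have "norm (rqfac n) \<le> C" for n
    using C(1) C(2)[of "nat n"] by (cases "n < 0") auto
  moreover have "C \<ge> 1" using C(2)[of 0] by simp
  ultimately show thesis using that by blast
qed

lemma q_binomial_abs_summable:
  assumes "norm z < 1"
  shows "(\<lambda>n. norm (qpochhammer a q n * rqfac (int n) * z ^ n)) summable_on UNIV"
proof -
  have "(\<lambda>n. qpochhammer a q n * rqfac (int n)) \<longlonglongrightarrow> qpoch_inf a q * (1 / qpoch_inf q q)"
    using rqfac_tendsto[of 0] by (intro tendsto_mult qpochhammer_tendsto norm_q_less_1) simp
  then obtain C where C: "\<And>n. norm (qpochhammer a q n * rqfac (int n)) \<le> C"
    using tendsto_imp_norm_bounded by blast
  have "(\<lambda>n. norm z ^ n) summable_on UNIV"
    using assms by (intro summable_nonneg_imp_summable_on summable_geometric) auto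
  hence "(\<lambda>n. C * norm z ^ n) summable_on UNIV"
    by (rule summable_on_cmult_right)
  thus ?thesis
    by (rule Infinite_Sum.abs_summable_on_comparison_test')
       (use C in \<open>auto simp: norm_mult norm_power intro!: mult_right_mono\<close>)
qed

definition q_binomial_series :: "complex \<Rightarrow> complex \<Rightarrow> complex" where
  "q_binomial_series a z = (\<Sum>n. qpochhammer a q n * rqfac (int n) * z ^ n)"

lemma q_binomial_series_sums:
  assumes "norm z < 1"
  shows "(\<lambda>n. qpochhammer a q n * rqfac (int n) * z ^ n) sums q_binomial_series a z"
  using q_binomial_abs_summable[OF assms, of a] unfolding q_binomial_series_def
  by (intro summable_sums summable_on_imp_summable) (rule abs_summable_summable)

lemma q_binomial_series_rec:
  assumes norm_z: "norm z < 1"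
  shows "(1 - z) * q_binomial_series a z = (1 - a * z) * q_binomial_series a (z * q)"
proof -
  define t where "t x n = qpochhammer a q n * rqfac (int n) * x ^ n" for x n
  have "norm (z * q) < 1"
    using norm_mult_power_less_1[OF norm_z norm_q_less_1, of 1] by simp
  hence sums: "t z sums q_binomial_series a z" "t (z * q) sums q_binomial_series a (z * q)"
    unfolding t_def using norm_z by (auto intro: q_binomial_series_sums)
  have "t z (Suc n) - t (z * q) (Suc n) = z * t z n - a * z * t (z * q) n" for n
    unfolding t_def qpochhammer_Suc rqfac_Suc[of n]
    by (simp add: algebra_simps)
  moreover have "(\<lambda>n. z * t z n - a * z * t (z * q) n) sums
      (z * q_binomial_series a z - a * z * q_binomial_series a (z * q))"
    by (intro sums_diff sums_mult sums)
  ultimately have "(\<lambda>n. t z n - t (z * q) n) sums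
      (z * q_binomial_series a z - a * z * q_binomial_series a (z * q))"
    using sums_Suc_iff[of "\<lambda>n. t z n - t (z * q) n"] by (simp add: t_def)
  moreover have "(\<lambda>n. t z n - t (z * q) n) sums (q_binomial_series a z - q_binomial_series a (z * q))"
    by (intro sums_diff sums)
  ultimately have "z * q_binomial_series a z - a * z * q_binomial_series a (z * q)
      = q_binomial_series a z - q_binomial_series a (z * q)"
    by (rule sums_unique2)
  thus ?thesis by (simp add: algebra_simps)
qed

theorem q_binomial_theorem:
  assumes norm_z: "norm z < 1"
  shows "((\<lambda>n. qpochhammer a q n * rqfac (int n) * z ^ n) has_sum
           qpoch_inf (a * z) q / qpoch_inf z q) UNIV"
proof -
  let ?f = "q_binomial_series a"
  have iterate: "qpochhammer z q n * ?f z = qpochhammer (a * z) q n * ?f (z * q ^ n)" for n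
  proof (induction n)
    case (Suc n)
    have "qpochhammer z q (Suc n) * ?f z
        = qpochhammer (a * z) q n * ((1 - z * q ^ n) * ?f (z * q ^ n))"
      using Suc.IH by (simp add: qpochhammer_Suc mult.commute mult.left_commute)
    also have "(1 - z * q ^ n) * ?f (z * q ^ n) = (1 - a * (z * q ^ n)) * ?f (z * q ^ n * q)"
      by (intro q_binomial_series_rec norm_mult_power_less_1 norm_z norm_q_less_1)
    finally show ?case by (simp add: qpochhammer_Suc mult_ac)
  qed simp
  have "isCont ?f 0"
    unfolding q_binomial_series_def
    by (rule isCont_powser[where K = q])
       (use q_binomial_series_sums[OF norm_q_less_1] in \<open>auto simp: sums_iff\<close>)
  moreover have "?f 0 = 1"
    by (simp add: q_binomial_series_def)
  moreover have "(\<lambda>n. z * q ^ n) \<longlonglongrightarrow> z * 0"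
    by (intro tendsto_intros LIMSEQ_power_zero norm_q_less_1)
  ultimately have "(\<lambda>n. ?f (z * q ^ n)) \<longlonglongrightarrow> 1"
    using isCont_tendsto_compose[of 0 ?f] by fastforce
  hence "(\<lambda>n. qpochhammer (a * z) q n * ?f (z * q ^ n)) \<longlonglongrightarrow> qpoch_inf (a * z) q * 1"
    by (intro tendsto_mult qpochhammer_tendsto norm_q_less_1)
  moreover have "(\<lambda>n. qpochhammer z q n * ?f z) \<longlonglongrightarrow> qpoch_inf z q * ?f z"
    by (intro tendsto_mult tendsto_const qpochhammer_tendsto norm_q_less_1)
  ultimately have "qpoch_inf z q * ?f z = qpoch_inf (a * z) q"
    unfolding iterate using LIMSEQ_unique by fastforce
  hence "?f z = qpoch_inf (a * z) q / qpoch_inf z q"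
    using qpoch_inf_nonzero[OF norm_q_less_1 norm_z] by (simp add: field_simps)
  moreover have "((\<lambda>n. qpochhammer a q n * rqfac (int n) * z ^ n) has_sum ?f z) UNIV"
    using q_binomial_abs_summable[OF norm_z, of a] q_binomial_series_sums[OF norm_z, of a]
    by (intro norm_summable_imp_has_sum summable_on_imp_summable) auto
  ultimately show ?thesis by simp
qed

lemma heine_exchange:
  assumes norm_b: "norm b < 1" and norm_z: "norm z < 1"
    and total: "((\<lambda>m. qpochhammer d q m * rqfac (int m) * b ^ m *
              (qpoch_inf (a * (z * q ^ m)) q / qpoch_inf (z * q ^ m) q)) has_sum S) UNIV"
  shows "((\<lambda>n. qpochhammer a q n * rqfac (int n) * z ^ n *
              (qpoch_inf (d * (b * q ^ n)) q / qpoch_inf (b * q ^ n) q)) has_sum S) UNIV"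
proof -
  define A where "A n = qpochhammer a q n * rqfac (int n) * z ^ n" for n
  define B where "B m = qpochhammer d q m * rqfac (int m) * b ^ m" for m
  have "((\<lambda>n. A n * (qpoch_inf (d * (b * q ^ n)) q / qpoch_inf (b * q ^ n) q)) has_sum S) UNIV"
  proof (rule has_sum_exchange[where f = "\<lambda>n m. A n * B m * q ^ (n * m)" and g = A and h = B])
    show "(\<lambda>n. norm (A n)) summable_on UNIV" "(\<lambda>m. norm (B m)) summable_on UNIV"
      unfolding A_def B_def using norm_z norm_b by (auto intro: q_binomial_abs_summable)
    have "norm q ^ (n * m) \<le> 1" for n m using norm_q_less_1 by (simp add: power_le_one)
    thus "norm (A n * B m * q ^ (n * m)) \<le> norm (A n) * norm (B m)" for n m
      by (simp add: norm_mult norm_power mult_left_le)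
    show "((\<lambda>m. B m * (qpoch_inf (a * (z * q ^ m)) q / qpoch_inf (z * q ^ m) q)) has_sum S) UNIV"
      using total by (simp add: B_def)
  next
    fix n
    have "((\<lambda>m. A n * (qpochhammer d q m * rqfac (int m) * (b * q ^ n) ^ m)) has_sum
        A n * (qpoch_inf (d * (b * q ^ n)) q / qpoch_inf (b * q ^ n) q)) UNIV"
      by (intro has_sum_cmult_right q_binomial_theorem norm_mult_power_less_1 norm_q_less_1 norm_b)
    thus "((\<lambda>m. A n * B m * q ^ (n * m)) has_sum
        A n * (qpoch_inf (d * (b * q ^ n)) q / qpoch_inf (b * q ^ n) q)) UNIV"
      by (simp add: B_def power_mult_distrib mult_ac flip: power_mult)
  next
    fix m
    have "((\<lambda>n. B m * (qpochhammer a q n * rqfac (int n) * (z * q ^ m) ^ n)) has_sum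
        B m * (qpoch_inf (a * (z * q ^ m)) q / qpoch_inf (z * q ^ m) q)) UNIV"
      by (intro has_sum_cmult_right q_binomial_theorem norm_mult_power_less_1 norm_q_less_1 norm_z)
    thus "((\<lambda>n. A n * B m * q ^ (n * m)) has_sum
        B m * (qpoch_inf (a * (z * q ^ m)) q / qpoch_inf (z * q ^ m) q)) UNIV"
      by (simp add: A_def power_mult_distrib mult_ac flip: power_mult)
  qed
  thus ?thesis by (simp add: A_def)
qed

theorem q_gauss_sum:
  assumes norm_b: "norm b < 1" and norm_z: "norm z < 1"
    and denominator_nonzero: "qpoch_inf (a * b * z) q \<noteq> 0"
  shows "((\<lambda>n. qpochhammer a q n * qpochhammer b q n / qpochhammer (a * b * z) q n *
        rqfac (int n) * z ^ n) has_sum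
      qpoch_inf (a * z) q * qpoch_inf (b * z) q / (qpoch_inf (a * b * z) q * qpoch_inf z q)) UNIV"
proof -
  let ?P = "\<lambda>x. qpoch_inf x q"
  have qpoch_b_nonzero: "?P b \<noteq> 0" and qpoch_z_nonzero: "?P z \<noteq> 0"
    using norm_b norm_z qpoch_inf_nonzero[OF norm_q_less_1] by auto
  have "((\<lambda>m. ?P (a * z) / ?P z * (qpochhammer z q m * rqfac (int m) * b ^ m))
      has_sum ?P (a * z) / ?P z * (?P (z * b) / ?P b)) UNIV"
    by (intro has_sum_cmult_right q_binomial_theorem norm_b)
  moreover have "?P (a * z) / ?P z * (qpochhammer z q m * rqfac (int m) * b ^ m)
      = qpochhammer (a * z) q m * rqfac (int m) * b ^ m * (?P (a * (z * q ^ m)) / ?P (z * q ^ m))" for m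
    using qpoch_inf_split[OF norm_q_less_1, of "a * z" m] qpoch_inf_split[OF norm_q_less_1, of z m]
      qpoch_z_nonzero by (simp add: mult.assoc)
  ultimately have "((\<lambda>n. qpochhammer a q n * rqfac (int n) * z ^ n *
      (?P (a * z * (b * q ^ n)) / ?P (b * q ^ n))) has_sum ?P (a * z) / ?P z * (?P (z * b) / ?P b)) UNIV"
    using heine_exchange[OF norm_b norm_z, of "a * z" a] by simp
  hence "((\<lambda>n. ?P b / ?P (a * b * z) * (qpochhammer a q n * rqfac (int n) * z ^ n *
      (?P (a * z * (b * q ^ n)) / ?P (b * q ^ n)))) has_sum
      ?P b / ?P (a * b * z) * (?P (a * z) / ?P z * (?P (z * b) / ?P b))) UNIV"
    by (rule has_sum_cmult_right)
  moreover have "?P b / ?P (a * b * z) * (qpochhammer a q n * rqfac (int n) * z ^ n *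
        (?P (a * z * (b * q ^ n)) / ?P (b * q ^ n))) =
      qpochhammer a q n * qpochhammer b q n / qpochhammer (a * b * z) q n * rqfac (int n) * z ^ n" for n
    using qpoch_inf_split[OF norm_q_less_1, of b n] qpoch_inf_split[OF norm_q_less_1, of "a * b * z" n]
      qpoch_b_nonzero denominator_nonzero by (simp add: mult_ac)
  ultimately show ?thesis
    using qpoch_b_nonzero by (simp add: mult_ac)
qed

section \<open>The finite and the infinite triple product\<close>

definition theta_term :: "complex \<Rightarrow> int \<Rightarrow> complex" where
  "theta_term z s = (- z) powi s * q powi tri s"

lemma theta_term_nonzero: "z \<noteq> 0 \<Longrightarrow> theta_term z s \<noteq> 0"
  by (simp add: theta_term_def)

lemma theta_term_add:
  assumes "z \<noteq> 0"
  shows "theta_term z (s + t) = theta_term z s * theta_term z t * q powi (s * t)"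
  using assms by (simp add: theta_term_def tri_add power_int_add mult_ac)

lemma theta_term_Suc:
  assumes "z \<noteq> 0"
  shows "theta_term z (s + 1) = - z * q powi s * theta_term z s"
  using theta_term_add[OF assms, of s 1] by (simp add: theta_term_def)

lemma theta_term_base_shift: "theta_term (z * q powi a) s = theta_term z s * q powi (a * s)"
  using power_int_mult_distrib[of "- z" "q powi a" s]
  by (simp add: theta_term_def power_int_mult mult_ac)

lemma theta_term_one_reflect: "theta_term 1 (- 1 - s) = - (q powi (2 * s + 1) * theta_term 1 s)"
proof -
  have "tri (- 1 - s) = (2 * s + 1) + tri s"
    using two_tri[of "- 1 - s"] two_tri[of s] by (simp add: algebra_simps)
  moreover have "- 1 - s = - (s + 1)" by simp
  hence "(- 1) powi (- 1 - s) = - ((- 1) powi s :: complex)"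
    by (simp only: power_int_minus_one_minus) (simp add: power_int_add)
  ultimately show ?thesis
    by (simp only: theta_term_def powi_add) simp
qed

lemma gauss_binomial_term_rec:
  fixes N :: int
  assumes z_nonzero: "z \<noteq> 0"
  defines "t \<equiv> \<lambda>N j. theta_term z j * rqfac j * rqfac (N - j)"
  shows "t N j - z * q powi N * t N (j - 1) = (1 - q powi (N + 1)) * t (N + 1) j"
proof -
  define y where "y = q powi (N + 1 - j)"
  have "q powi N = y * q powi (j - 1)"
    unfolding y_def powi_add[symmetric] by simp
  hence "z * q powi N * theta_term z (j - 1) = - (y * theta_term z j)"
    using theta_term_Suc[OF z_nonzero, of "j - 1"] by simp
  moreover have "N - (j - 1) = N + 1 - j" by simp
  ultimately have "z * q powi N * t N (j - 1)
      = - (y * theta_term z j) * ((1 - q powi j) * rqfac j) * rqfac (N + 1 - j)"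
    unfolding t_def rqfac_diff_1[symmetric] by (simp only: mult.assoc[symmetric])
  moreover have "N - j = N + 1 - j - 1" by simp
  hence "t N j = theta_term z j * rqfac j * ((1 - y) * rqfac (N + 1 - j))"
    unfolding t_def y_def rqfac_diff_1[symmetric] by (simp only:)
  moreover have "q powi (N + 1) = q powi j * y"
    unfolding y_def powi_add[symmetric] by simp
  moreover have "t (N + 1) j = theta_term z j * rqfac j * rqfac (N + 1 - j)"
    by (simp only: t_def)
  ultimately show ?thesis
    by (simp only:) (simp add: algebra_simps)
qed

theorem gauss_binomial_sum:
  assumes z_nonzero: "z \<noteq> 0"
  shows "((\<lambda>j. theta_term z j * rqfac j * rqfac (int N - j)) has_sum
           rqfac (int N) * qpochhammer z q N) UNIV"
proof (induction N)
  case 0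
  have "rqfac j * rqfac (- j) = 0" if "j \<noteq> 0" for j
    using that by (cases "j < 0") auto
  thus ?case by (intro has_sum_finite_neutralI[of "{0}"]) (auto simp: theta_term_def)
next
  case (Suc N)
  define t where "t N j = theta_term z j * rqfac j * rqfac (N - j)" for N j
  define F where "F = rqfac (int N) * qpochhammer z q N"
  have sum: "(t (int N) has_sum F) UNIV"
    unfolding t_def F_def by (rule Suc.IH)
  hence "((\<lambda>j. t (int N) (j + - 1)) has_sum F) UNIV"
    by (subst has_sum_int_shift)
  hence "((\<lambda>j. t (int N) j + - (z * q ^ N) * t (int N) (j + - 1)) has_sum F + - (z * q ^ N) * F) UNIV"
    by (intro has_sum_add has_sum_cmult_right sum)
  also have "(\<lambda>j. t (int N) j + - (z * q ^ N) * t (int N) (j + - 1))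
      = (\<lambda>j. (1 - q ^ Suc N) * t (int (Suc N)) j)"
    using gauss_binomial_term_rec[OF z_nonzero, where N = "int N"]
    by (simp add: t_def power_int_add add.commute mult.commute)
  also have "F + - (z * q ^ N) * F = (1 - q ^ Suc N) * (rqfac (int (Suc N)) * qpochhammer z q (Suc N))"
    unfolding F_def rqfac_Suc[of N] by (simp add: qpochhammer_Suc algebra_simps)
  finally show ?case
    using power_neq_1[of "Suc N"]
    by (subst (asm) has_sum_cmult_right_iff) (auto simp: t_def[abs_def])
qed

lemma qpochhammer_negative_shift:
  assumes z_nonzero: "z \<noteq> 0"
  shows "qpochhammer (z * q powi (- int m)) q m
    = theta_term z (int m) * q powi (- (int m)\<^sup>2) * qpochhammer (q / z) q m"
proof -
  have "q powi (1 - int m) / (q / z) = z * q powi (- int m)"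
    using z_nonzero by (simp add: power_int_diff power_int_minus field_simps)
  hence "theta_term z (int m) * q powi (- (int m)\<^sup>2) * qpochhammer (q / z) q m
      = theta_term z (int m) * q powi (- (int m)\<^sup>2) * ((- (q / z)) ^ m * q powi tri (int m)) *
        qpochhammer (z * q powi (- int m)) q m"
    using qpochhammer_reverse[of "q / z" q m] z_nonzero by simp
  also have "theta_term z (int m) * q powi (- (int m)\<^sup>2) * ((- (q / z)) ^ m * q powi tri (int m)) = 1"
  proof -
    have "tri (int m) + tri (int m) + int m = (int m)\<^sup>2"
      using two_tri[of "int m"] by (simp add: power2_eq_square algebra_simps)
    hence "q powi tri (int m) * q powi tri (int m) * q ^ m * q powi (- (int m)\<^sup>2) = 1"
      by (simp flip: powi_add power_int_of_nat)
    moreover have "q ^ m = (- z) ^ m * (- (q / z)) ^ m"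
      using z_nonzero by (simp flip: power_mult_distrib)
    ultimately show ?thesis
      by (simp only: theta_term_def power_int_of_nat mult_ac)
  qed
  finally show ?thesis by simp
qed

theorem finite_triple_product:
  assumes z_nonzero: "z \<noteq> 0"
  shows "((\<lambda>s. theta_term z s * rqfac (int n - s) * rqfac (int m + s)) has_sum
           rqfac (int (n + m)) * qpochhammer z q n * qpochhammer (q / z) q m) UNIV"
proof -
  define w where "w = z * q powi (- int m)"
  define K where "K = theta_term z (int m) * q powi (- (int m)\<^sup>2)"
  have "((\<lambda>j. theta_term w j * rqfac j * rqfac (int (n + m) - j)) has_sum
      rqfac (int (n + m)) * qpochhammer w q (m + n)) UNIV"
    using gauss_binomial_sum[of w "n + m"] z_nonzero by (simp add: w_def add.commute)
  hence "((\<lambda>s. theta_term w (s + int m) * rqfac (s + int m) *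
        rqfac (int (n + m) - (s + int m))) has_sum
      rqfac (int (n + m)) * qpochhammer w q (m + n)) UNIV"
    by (subst has_sum_int_shift[of "\<lambda>j. theta_term w j * rqfac j * rqfac (int (n + m) - j)"])
  moreover have "theta_term w (s + int m) = K * theta_term z s" for s
  proof -
    have "q powi (s * int m) * q powi (- int m * (s + int m)) = q powi (- (int m)\<^sup>2)"
      by (simp add: power2_eq_square algebra_simps flip: powi_add)
    thus ?thesis
      unfolding w_def theta_term_base_shift theta_term_add[OF z_nonzero] K_def by (simp add: mult_ac)
  qed
  moreover have "w * q ^ m = z"
    by (simp add: w_def power_int_minus)
  with qpochhammer_negative_shift[OF z_nonzero, of m]
  have "qpochhammer w q (m + n) = K * (qpochhammer z q n * qpochhammer (q / z) q m)"
    by (simp add: qpochhammer_add K_def mult.assoc flip: w_def)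
  ultimately have "((\<lambda>s. K * (theta_term z s * rqfac (int n - s) * rqfac (int m + s))) has_sum
      K * (rqfac (int (n + m)) * qpochhammer z q n * qpochhammer (q / z) q m)) UNIV"
    by (simp add: mult_ac add.commute)
  moreover have "K \<noteq> 0" using z_nonzero by (simp add: K_def theta_term_nonzero)
  ultimately show ?thesis
    by (subst (asm) has_sum_cmult_right_iff) auto
qed

lemma theta_term_abs_summable:
  assumes "z \<noteq> 0"
  shows "(\<lambda>s. norm (theta_term z s)) summable_on UNIV"
proof -
  have nonneg: "theta_term z summable_on {0..}" if z_nonzero: "z \<noteq> 0" for z
  proof -
    have step: "theta_term z (int (Suc n)) = theta_term z (int n) * (- z * q ^ n)" for n
      using theta_term_Suc[OF z_nonzero, of "int n"] by (simp add: add.commute)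
    have "summable (\<lambda>n. norm (theta_term z (int n)))"
    proof (rule summable_ratio_tendsto)
      show "norm (norm (theta_term z (int (Suc n))))
          \<le> norm z * norm q ^ n * norm (norm (theta_term z (int n)))" for n
        by (simp only: step) (simp add: norm_mult norm_power)
      show "(\<lambda>n. norm z * norm q ^ n) \<longlonglongrightarrow> norm z * 0"
        using norm_q_less_1 by (intro tendsto_intros LIMSEQ_power_zero) simp
    qed simp
    hence "(\<lambda>n. theta_term z (int n)) summable_on UNIV"
      by (rule norm_summable_imp_summable_on)
    also have "?this \<longleftrightarrow> ?thesis"
      by (rule summable_on_reindex_bij_witness[of _ nat int]) auto
    finally show ?thesis .
  qed
  have "theta_term z (1 - s) = - z * theta_term (inverse z) s" for s
  proof -
    have "(- z) powi (1 - s) = - z * (- inverse z) powi s"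
      using assms
      by (simp add: power_int_diff power_int_inverse divide_inverse flip: inverse_minus_eq)
    thus ?thesis by (simp add: theta_term_def tri_reflect)
  qed
  moreover have "(\<lambda>s. - z * theta_term (inverse z) s) summable_on {0..}"
    using assms by (intro summable_on_cmult_right nonneg) simp
  ultimately have "(\<lambda>s. theta_term z (1 - s)) summable_on {0..}"
    by simp
  also have "?this \<longleftrightarrow> theta_term z summable_on {..1}"
    by (rule summable_on_reindex_bij_witness[of _ "\<lambda>s. 1 - s" "\<lambda>s. 1 - s"]) auto
  finally have "theta_term z summable_on ({0..} \<union> {..1})"
    using nonneg[OF assms] by (intro summable_on_union)
  moreover have "{0..} \<union> {..1} = (UNIV :: int set)" by auto
  ultimately show ?thesis by (simp add: summable_on_iff_abs_summable_on_complex)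
qed

theorem jacobi_triple_product:
  assumes z_nonzero: "z \<noteq> 0"
  shows "(theta_term z has_sum qpoch_inf z q * qpoch_inf (q / z) q * qpoch_inf q q) UNIV"
proof -
  let ?r = "1 / qpoch_inf q q"
  obtain C where C: "C \<ge> 1" "\<And>n. norm (rqfac n) \<le> C" using rqfac_bounded by blast
  have "((\<lambda>s. theta_term z s * ?r * ?r) has_sum ?r * qpoch_inf z q * qpoch_inf (q / z) q) UNIV"
  proof (rule has_sum_tannery[where F = sequentially])
    show "((\<lambda>s. theta_term z s * rqfac (int n - s) * rqfac (int n + s)) has_sum
        rqfac (int (n + n)) * qpochhammer z q n * qpochhammer (q / z) q n) UNIV" for n
      using z_nonzero by (rule finite_triple_product)
    show "norm (theta_term z s * rqfac (int n - s) * rqfac (int n + s))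
        \<le> norm (theta_term z s) * (C * C)" for n s
      unfolding norm_mult mult.assoc using C by (intro mult_mono mult_nonneg_nonneg) auto
    show "(\<lambda>s. norm (theta_term z s) * (C * C)) summable_on UNIV"
      using z_nonzero by (intro summable_on_cmult_left theta_term_abs_summable)
    show "(\<lambda>n. theta_term z s * rqfac (int n - s) * rqfac (int n + s)) \<longlonglongrightarrow> theta_term z s * ?r * ?r" for s
      using rqfac_tendsto[of "- s"] by (intro tendsto_intros rqfac_tendsto) simp
    have "(\<lambda>n. rqfac (int (n + n))) \<longlonglongrightarrow> ?r"
      using LIMSEQ_subseq_LIMSEQ[OF rqfac_tendsto[of 0], of "\<lambda>n. n + n"]
      by (auto simp: strict_mono_def o_def)
    thus "(\<lambda>n. rqfac (int (n + n)) * qpochhammer z q n * qpochhammer (q / z) q n)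
        \<longlonglongrightarrow> ?r * qpoch_inf z q * qpoch_inf (q / z) q"
      by (intro tendsto_mult qpochhammer_tendsto norm_q_less_1)
  qed simp
  hence "((\<lambda>s. qpoch_inf q q * qpoch_inf q q * (theta_term z s * ?r * ?r)) has_sum
      qpoch_inf q q * qpoch_inf q q * (?r * qpoch_inf z q * qpoch_inf (q / z) q)) UNIV"
    by (rule has_sum_cmult_right)
  thus ?thesis using qpoch_inf_q_nonzero by (simp add: mult_ac)
qed

lemma
  assumes "m > 0"
  shows theta_powers_abs_summable: "(\<lambda>s. norm (q powi (int m * tri s + b * s))) summable_on UNIV"
    and jacobi_triple_product_powers: "((\<lambda>s. (- 1) powi s * q powi (int m * tri s + b * s)) has_sum
      qpoch_inf (q powi b) (q ^ m) * qpoch_inf (q ^ m / q powi b) (q ^ m) * qpoch_inf (q ^ m) (q ^ m)) UNIV"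
proof -
  have "norm (q ^ m) < 1"
    using assms norm_q_less_1 by (simp add: norm_power power_less_one_iff)
  then interpret power: q_base "q ^ m" by unfold_locales simp_all
  have theta_power: "power.theta_term (q powi b) s = (- 1) powi s * q powi (int m * tri s + b * s)" for s
  proof -
    have "(- (q powi b)) powi s = (- 1) powi s * q powi (b * s)"
      by (metis mult_minus1 power_int_mult power_int_mult_distrib)
    moreover have "(q ^ m) powi tri s = q powi (int m * tri s)"
      by (simp add: power_int_mult)
    ultimately show ?thesis by (simp add: power.theta_term_def powi_add)
  qed
  have "norm ((- 1 :: complex) powi s) = 1" for s
    by (simp add: norm_power_int)
  thus "(\<lambda>s. norm (q powi (int m * tri s + b * s))) summable_on UNIV"
    using power.theta_term_abs_summable[of "q powi b"] by (simp add: theta_power norm_mult)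
  show "((\<lambda>s. (- 1) powi s * q powi (int m * tri s + b * s)) has_sum
      qpoch_inf (q powi b) (q ^ m) * qpoch_inf (q ^ m / q powi b) (q ^ m) * qpoch_inf (q ^ m) (q ^ m)) UNIV"
    using power.jacobi_triple_product[of "q powi b"] by (simp add: theta_power[abs_def])
qed

section \<open>Bailey pairs\<close>

definition vandermonde_term :: "int \<Rightarrow> int \<Rightarrow> int \<Rightarrow> complex" where
  "vandermonde_term N a j = q powi (j * (j + a)) * rqfac (N - j) * rqfac j * rqfac (j + a)"

lemma vandermonde_term_eq_0: "j \<notin> {0..N} \<Longrightarrow> vandermonde_term N a j = 0"
  by (cases "j < 0") (auto simp: vandermonde_term_def)

lemma vandermonde_term_rec:
  fixes N a :: int
  defines "u \<equiv> \<lambda>j. q powi (j + 1 + a) * vandermonde_term N (a + 1) j"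
  shows "vandermonde_term N (a + 1) j - u j + u (j - 1)
    = (1 - q powi (N + 1)) * vandermonde_term (N + 1) a j"
proof -
  define y where "y = q powi (N + 1 - j)"
  define c where "c = q powi (j * (j + a))"
  have "q powi (j * (j + (a + 1))) = c * q powi j"
    by (simp add: c_def algebra_simps flip: powi_add)
  moreover have "rqfac (N - j) = (1 - y) * rqfac (N + 1 - j)"
    using rqfac_diff_1[of "N + 1 - j"] by (simp add: y_def algebra_simps)
  moreover have "rqfac (j + a) = (1 - q powi (j + 1 + a)) * rqfac (j + (a + 1))"
    using rqfac_diff_1[of "j + (a + 1)"] by (simp add: algebra_simps)
  moreover have "vandermonde_term N (a + 1) j - u j = q powi (j * (j + (a + 1))) * rqfac (N - j) *
      rqfac j * ((1 - q powi (j + 1 + a)) * rqfac (j + (a + 1)))"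
    unfolding vandermonde_term_def u_def by (simp add: algebra_simps)
  ultimately have "vandermonde_term N (a + 1) j - u j
      = c * q powi j * ((1 - y) * rqfac (N + 1 - j)) * rqfac j * rqfac (j + a)"
    by (simp only:)
  moreover have "u (j - 1) = c * rqfac (N + 1 - j) * ((1 - q powi j) * rqfac j) * rqfac (j + a)"
  proof -
    have "q powi (j + a) * q powi ((j - 1) * (j + a)) = c"
      by (simp add: c_def algebra_simps flip: powi_add)
    moreover have "N - (j - 1) = N + 1 - j" "j - 1 + (a + 1) = j + a" "j - 1 + 1 + a = j + a"
      by simp_all
    ultimately show ?thesis
      unfolding u_def vandermonde_term_def rqfac_diff_1[symmetric] by (simp only: mult.assoc[symmetric])
  qed
  moreover have "q powi (N + 1) = q powi j * y"
    unfolding y_def powi_add[symmetric] by simp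
  moreover have "vandermonde_term (N + 1) a j = c * rqfac (N + 1 - j) * rqfac j * rqfac (j + a)"
    by (simp only: vandermonde_term_def c_def)
  ultimately show ?thesis
    by (simp only:) (simp add: algebra_simps)
qed

theorem q_vandermonde_sum: "(vandermonde_term N a has_sum rqfac N * rqfac (N + a)) UNIV"
proof (cases "N < 0")
  case True
  hence "vandermonde_term N a j = 0" for j
    by (intro vandermonde_term_eq_0) auto
  hence "(vandermonde_term N a has_sum 0) UNIV"
    by (rule has_sum_0)
  thus ?thesis using True by simp
next
  case False
  have "(vandermonde_term (int n) a has_sum rqfac (int n) * rqfac (int n + a)) UNIV" for n
  proof (induction n arbitrary: a)
    case 0
    show ?case
      by (rule has_sum_finite_neutralI[of "{0}"])
         (auto intro: vandermonde_term_eq_0, simp add: vandermonde_term_def)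
  next
    case (Suc n)
    define u where "u j = q powi (j + 1 + a) * vandermonde_term (int n) (a + 1) j" for j
    obtain U where U: "(u has_sum U) UNIV"
      using has_sum_finite_neutralI[of "{0..int n}" UNIV u] vandermonde_term_eq_0 by (auto simp: u_def)
    hence "((\<lambda>j. u (j + - 1)) has_sum U) UNIV" by (subst has_sum_int_shift)
    hence "((\<lambda>j. vandermonde_term (int n) (a + 1) j + - u j + u (j + - 1)) has_sum
        rqfac (int n) * rqfac (int n + (a + 1)) + - U + U) UNIV"
      by (intro has_sum_add has_sum_uminusI U Suc.IH)
    also have "(\<lambda>j. vandermonde_term (int n) (a + 1) j + - u j + u (j + - 1)) =
        (\<lambda>j. (1 - q ^ Suc n) * vandermonde_term (int (Suc n)) a j)"
      using vandermonde_term_rec[of "int n" a]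
      by (simp add: u_def power_int_add add.commute mult.commute)
    also have "rqfac (int n) * rqfac (int n + (a + 1)) + - U + U
        = (1 - q ^ Suc n) * (rqfac (int (Suc n)) * rqfac (int (Suc n) + a))"
      unfolding rqfac_Suc[of n] by (simp add: add_ac)
    finally show ?case
      using power_neq_1[of "Suc n"] by (subst (asm) has_sum_cmult_right_iff) auto
  qed
  from this[of "nat N"] False show ?thesis by simp
qed

definition bailey_kernel :: "int \<Rightarrow> int \<Rightarrow> int \<Rightarrow> complex" where
  "bailey_kernel e n s = rqfac (n - s) * rqfac (n + s + e)"

text \<open>
  A Bailey pair relative to \<open>a = q\<^sup>e\<close>, in bilateral form; all sums over \<open>s\<close> have finite support.
\<close>

definition bailey_pair :: "int \<Rightarrow> (int \<Rightarrow> complex) \<Rightarrow> (int \<Rightarrow> complex) \<Rightarrow> bool" where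
  "bailey_pair e \<alpha> \<beta> \<longleftrightarrow> (\<forall>n. ((\<lambda>s. \<alpha> s * bailey_kernel e n s) has_sum \<beta> n) UNIV)"

definition bailey_op :: "int \<Rightarrow> (int \<Rightarrow> complex) \<Rightarrow> int \<Rightarrow> complex" where
  "bailey_op e \<beta> n = (\<Sum>r\<in>{0..n}. rqfac (n - r) * q powi (r\<^sup>2 + e * r) * \<beta> r)"

lemma bailey_pairD: "bailey_pair e \<alpha> \<beta> \<Longrightarrow> ((\<lambda>s. \<alpha> s * bailey_kernel e n s) has_sum \<beta> n) UNIV"
  by (simp add: bailey_pair_def)

lemma bailey_kernel_eq_0: "s \<notin> {- n - e..n} \<Longrightarrow> bailey_kernel e n s = 0"
  by (cases "n - s < 0") (auto simp: bailey_kernel_def)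

lemma bailey_kernel_neg: "e \<le> 1 \<Longrightarrow> n < 0 \<Longrightarrow> bailey_kernel e n s = 0"
  by (rule bailey_kernel_eq_0) auto

lemma bailey_kernel_reflect: "bailey_kernel e n (- e - s) = bailey_kernel e n s"
  by (simp add: bailey_kernel_def algebra_simps)

lemma sum_bailey_kernel:
  assumes "e \<le> 1"
  shows "(\<Sum>r\<in>{0..n}. rqfac (n - r) * q powi (r\<^sup>2 + e * r) * bailey_kernel e r s)
    = q powi (s\<^sup>2 + e * s) * bailey_kernel e n s"
proof -
  let ?f = "\<lambda>r. rqfac (n - r) * q powi (r\<^sup>2 + e * r) * bailey_kernel e r s"
  have "q powi (s\<^sup>2 + e * s) * vandermonde_term (n - s) (2 * s + e) j = ?f (j + s)" for j
  proof -
    have "s\<^sup>2 + e * s + j * (j + (2 * s + e)) = (j + s)\<^sup>2 + e * (j + s)"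
      by (simp add: power2_eq_square algebra_simps)
    hence "q powi (s\<^sup>2 + e * s) * q powi (j * (j + (2 * s + e))) = q powi ((j + s)\<^sup>2 + e * (j + s))"
      by (simp only: powi_add[symmetric])
    thus ?thesis by (simp add: vandermonde_term_def bailey_kernel_def algebra_simps)
  qed
  hence "((\<lambda>j. ?f (j + s)) has_sum
      q powi (s\<^sup>2 + e * s) * (rqfac (n - s) * rqfac (n - s + (2 * s + e)))) UNIV"
    using has_sum_cmult_right[OF q_vandermonde_sum[of "n - s" "2 * s + e"], of "q powi (s\<^sup>2 + e * s)"]
    by simp
  hence "(?f has_sum q powi (s\<^sup>2 + e * s) * bailey_kernel e n s) UNIV"
    by (subst (asm) has_sum_int_shift) (simp add: bailey_kernel_def algebra_simps)
  also have "?this \<longleftrightarrow> (?f has_sum q powi (s\<^sup>2 + e * s) * bailey_kernel e n s) {0..n}"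
    by (rule has_sum_cong_neutral) (auto simp: bailey_kernel_neg[OF assms] not_le)
  finally show ?thesis by (simp add: has_sum_finite_iff)
qed

theorem bailey_lemma:
  assumes pair: "bailey_pair e \<alpha> \<beta>" and "e \<le> 1"
  shows "bailey_pair e (\<lambda>s. q powi (s\<^sup>2 + e * s) * \<alpha> s) (bailey_op e \<beta>)"
  unfolding bailey_pair_def
proof
  fix n
  have "((\<lambda>s. \<Sum>r\<in>{0..n}. rqfac (n - r) * q powi (r\<^sup>2 + e * r) * (\<alpha> s * bailey_kernel e r s))
      has_sum bailey_op e \<beta> n) UNIV"
    unfolding bailey_op_def
    by (intro has_sum_sum has_sum_cmult_right bailey_pairD[OF pair]) auto
  moreover have "(\<Sum>r\<in>{0..n}. rqfac (n - r) * q powi (r\<^sup>2 + e * r) * (\<alpha> s * bailey_kernel e r s))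
      = \<alpha> s * (q powi (s\<^sup>2 + e * s) * bailey_kernel e n s)" for s
    unfolding sum_bailey_kernel[OF \<open>e \<le> 1\<close>, symmetric] sum_distrib_left by (simp add: mult_ac)
  ultimately show "((\<lambda>s. q powi (s\<^sup>2 + e * s) * \<alpha> s * bailey_kernel e n s) has_sum bailey_op e \<beta> n) UNIV"
    by (simp add: mult_ac)
qed

corollary bailey_lemma_iterated:
  assumes "bailey_pair e \<alpha> \<beta>" and "e \<le> 1"
  shows "bailey_pair e (\<lambda>s. q powi (int m * (s\<^sup>2 + e * s)) * \<alpha> s) ((bailey_op e ^^ m) \<beta>)"
proof (induction m)
  case (Suc m)
  have "q powi (int (Suc m) * (s\<^sup>2 + e * s)) = q powi (s\<^sup>2 + e * s) * q powi (int m * (s\<^sup>2 + e * s))" for s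
    by (simp add: distrib_right flip: powi_add)
  thus ?case using bailey_lemma[OF Suc.IH \<open>e \<le> 1\<close>] by (simp add: mult.assoc)
qed (use assms in simp)

definition unit_seq :: "int \<Rightarrow> complex" where
  "unit_seq n = (if n = 0 then 1 else 0)"

theorem unit_bailey_pair: "bailey_pair 1 (theta_term 1) unit_seq"
  unfolding bailey_pair_def
proof
  fix n :: int
  show "((\<lambda>s. theta_term 1 s * bailey_kernel 1 n s) has_sum unit_seq n) UNIV"
  proof (cases "n < 0")
    case True
    thus ?thesis by (simp add: bailey_kernel_neg unit_seq_def)
  next
    case False
    then obtain m where n: "n = int m" by (metis nonneg_int_cases not_less)
    have "rqfac (int (m + Suc m)) * qpochhammer 1 q m * qpochhammer q q (Suc m) = unit_seq n"
    proof (cases m)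
      case 0
      thus ?thesis
        using qpochhammer_q_nonzero[of 1] rqfac_of_nat[of 1] by (simp add: n unit_seq_def)
    next
      case (Suc l)
      thus ?thesis by (simp add: n unit_seq_def qpochhammer_Suc_left)
    qed
    with finite_triple_product[of 1 m "Suc m"] show ?thesis
      by (simp add: n bailey_kernel_def mult.assoc add_ac)
  qed
qed

text \<open>
  On terms antisymmetric under \<open>s \<mapsto> - 1 - s\<close> the kernel relative to \<open>a = q\<close> sums to \<open>0\<close>; up to
  such terms, \<open>(1 + q\<^sup>s) (1 - q\<^bsup>n + s + 1\<^esup>)\<close> acts on \<open>\<alpha>\<close> as \<open>1 + q\<^sup>n\<close>.
\<close>

theorem bailey_pair_1_imp_0:
  assumes pair: "bailey_pair 1 \<alpha> \<beta>"
    and reflect: "\<And>s. \<alpha> (- 1 - s) = - (q powi (2 * s + 1) * \<alpha> s)"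
  shows "bailey_pair 0 (\<lambda>s. (1 + q powi s) * \<alpha> s) (\<lambda>n. (1 + q powi n) * \<beta> n)"
  unfolding bailey_pair_def
proof
  fix n
  define f where "f s = \<alpha> s * bailey_kernel 1 n s" for s
  have f_has_sum: "(f has_sum \<beta> n) UNIV"
    using bailey_pairD[OF pair] by (simp add: f_def[abs_def])
  have f_reflect: "f (- 1 - s) = - (q powi (2 * s + 1) * f s)" for s
    by (simp add: f_def reflect bailey_kernel_reflect)
  hence reflected: "((\<lambda>s. - (q powi (2 * s + 1) * f s)) has_sum \<beta> n) UNIV"
    using f_has_sum has_sum_int_reflect[of f "- 1" "\<beta> n"] by simp
  have antisymmetric: "((\<lambda>s. q powi s * f s) has_sum 0) UNIV"
  proof -
    obtain S where S: "((\<lambda>s. q powi s * f s) has_sum S) UNIV"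
      using has_sum_finite_neutralI[of "{- n - 1..n}" UNIV "\<lambda>s. q powi s * f s"]
        bailey_kernel_eq_0[of _ n 1] by (auto simp: f_def)
    have "q powi (- 1 - s) * q powi (2 * s + 1) = q powi s" for s
      by (simp flip: powi_add)
    hence "q powi (- 1 - s) * f (- 1 - s) = - (q powi s * f s)" for s
      by (simp only: f_reflect mult_minus_right mult.assoc[symmetric])
    with S show ?thesis using has_sum_int_antisymmetric by blast
  qed
  have "((\<lambda>s. f s + (1 - q powi (n + 1)) * (q powi s * f s) + q powi n * - (q powi (2 * s + 1) * f s))
      has_sum \<beta> n + (1 - q powi (n + 1)) * 0 + q powi n * \<beta> n) UNIV"
    by (intro has_sum_add has_sum_cmult_right f_has_sum antisymmetric reflected)
  moreover have "f s + (1 - q powi (n + 1)) * (q powi s * f s) + q powi n * - (q powi (2 * s + 1) * f s)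
      = (1 + q powi s) * \<alpha> s * bailey_kernel 0 n s" for s
  proof -
    have "bailey_kernel 0 n s = (1 - q powi (n + s + 1)) * bailey_kernel 1 n s"
      by (simp add: bailey_kernel_def rqfac_conv_add_1[of "n + s"] mult_ac)
    moreover have "q powi (n + 1) * q powi s = q powi (n + s + 1)"
      and "q powi n * q powi (2 * s + 1) = q powi s * q powi (n + s + 1)"
      by (simp_all add: algebra_simps flip: powi_add)
    ultimately show ?thesis
      unfolding f_def by algebra
  qed
  ultimately show "((\<lambda>s. (1 + q powi s) * \<alpha> s * bailey_kernel 0 n s) has_sum (1 + q powi n) * \<beta> n) UNIV"
    by (simp add: algebra_simps)
qed

theorem bailey_transform:
  assumes pair: "bailey_pair e \<alpha> \<beta>"
    and \<alpha>_summable: "(\<lambda>s. norm (\<alpha> s)) summable_on UNIV"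
    and \<delta>_summable: "(\<lambda>n. norm (\<delta> n)) summable_on UNIV"
    and \<gamma>_has_sum: "\<And>s. ((\<lambda>n. \<delta> n * bailey_kernel e (int n) s) has_sum \<gamma> s) UNIV"
    and total: "((\<lambda>s. \<alpha> s * \<gamma> s) has_sum S) UNIV"
  shows "((\<lambda>n. \<delta> n * \<beta> (int n)) has_sum S) UNIV"
proof -
  obtain C where C: "C \<ge> 1" "\<And>n. norm (rqfac n) \<le> C" using rqfac_bounded by blast
  show ?thesis
  proof (rule has_sum_exchange[OF _ _ _ _ _ total])
    show "(\<lambda>n. norm (\<delta> n)) summable_on UNIV" by (rule \<delta>_summable)
    have "(\<lambda>s. norm (\<alpha> s) * (C * C)) summable_on UNIV"
      using \<alpha>_summable by (rule summable_on_cmult_left)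
    thus "(\<lambda>s. norm (norm (\<alpha> s) * (C * C))) summable_on UNIV"
      by (simp add: norm_mult)
    show "norm (\<delta> n * (\<alpha> s * bailey_kernel e (int n) s))
        \<le> norm (\<delta> n) * norm (norm (\<alpha> s) * (C * C))" for n s
      unfolding norm_mult bailey_kernel_def real_norm_def using C
      by (intro mult_left_mono) (auto simp: norm_mult intro!: mult_mono)
    show "((\<lambda>s. \<delta> n * (\<alpha> s * bailey_kernel e (int n) s)) has_sum \<delta> n * \<beta> (int n)) UNIV" for n
      by (intro has_sum_cmult_right bailey_pairD[OF pair])
    show "((\<lambda>n. \<delta> n * (\<alpha> s * bailey_kernel e (int n) s)) has_sum \<alpha> s * \<gamma> s) UNIV" for s
      using has_sum_cmult_right[OF \<gamma>_has_sum, of "\<alpha> s"] by (simp add: mult_ac)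
  qed
qed

end

section \<open>Sums over chains\<close>

text \<open>
  The tails \<open>n = N\<^sub>j \<ge> N\<^sub>j\<^sub>+\<^sub>1 \<ge> \<dots> \<ge> N\<^sub>k\<^sub>-\<^sub>1 \<ge> N\<^sub>k = 0\<close> of the summation tuples, with the entries
  before \<open>j\<close> set to \<open>0\<close>.
\<close>

definition chains :: "nat \<Rightarrow> nat \<Rightarrow> int \<Rightarrow> (nat \<Rightarrow> int) set" where
  "chains k j n = {N. N j = n \<and> (\<forall>l\<in>{j..<k}. 0 \<le> N (Suc l) \<and> N (Suc l) \<le> N l) \<and>
                      (\<forall>l. l < j \<or> k \<le> l \<longrightarrow> N l = 0)}"

definition chain_weight ::
  "nat \<Rightarrow> (nat \<Rightarrow> int \<Rightarrow> 'a) \<Rightarrow> (int \<Rightarrow> 'a) \<Rightarrow> nat \<Rightarrow> (nat \<Rightarrow> int) \<Rightarrow> 'a :: comm_semiring_1" where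
  "chain_weight k \<omega> \<rho> j N = (\<Prod>l\<in>{j..k}. \<omega> l (N l)) * (\<Prod>l\<in>{j..<k}. \<rho> (N l - N (Suc l)))"

definition chain_sum ::
  "nat \<Rightarrow> (nat \<Rightarrow> int \<Rightarrow> 'a) \<Rightarrow> (int \<Rightarrow> 'a) \<Rightarrow> nat \<Rightarrow> int \<Rightarrow> 'a :: comm_semiring_1" where
  "chain_sum k \<omega> \<rho> j n = (\<Sum>N\<in>chains k j n. chain_weight k \<omega> \<rho> j N)"

lemma chains_self: "chains k k n = (if n = 0 then {\<lambda>_. 0} else {})"
proof -
  have "N \<in> chains k k n \<longleftrightarrow> n = 0 \<and> (\<forall>l. N l = 0)" for N
    unfolding chains_def using not_le by auto
  thus ?thesis by (auto simp: fun_eq_iff)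
qed

lemma chains_nonneg:
  assumes "N \<in> chains k j n" and "0 \<le> n"
  shows "0 \<le> N l"
proof -
  consider (outside) "l < j \<or> k \<le> l" | (first) "l = j" | (later) "j < l" "l < k" by linarith
  thus ?thesis
  proof cases
    case later
    then obtain m where "l = Suc m" "m \<in> {j..<k}" by (cases l) auto
    thus ?thesis using assms by (simp add: chains_def)
  qed (use assms in \<open>auto simp: chains_def\<close>)
qed

lemma bij_betw_chains:
  assumes "j < k"
  shows "bij_betw (\<lambda>(r, M). M(j := n)) (SIGMA r:{0..n}. chains k (Suc j) r) (chains k j n)"
proof (rule bij_betwI[of _ _ _ "\<lambda>N. (N (Suc j), N(j := 0))"])
  show "(\<lambda>(r, M). M(j := n)) \<in> (SIGMA r:{0..n}. chains k (Suc j) r) \<rightarrow> chains k j n"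
  proof clarify
    fix r M assume r: "r \<in> {0..n}" and M: "M \<in> chains k (Suc j) r"
    have "0 \<le> (M(j := n)) (Suc l) \<and> (M(j := n)) (Suc l) \<le> (M(j := n)) l" if "l \<in> {j..<k}" for l
      using that r M by (cases "l = j") (auto simp: chains_def)
    thus "M(j := n) \<in> chains k j n"
      using M assms by (auto simp: chains_def)
  qed
  show "(\<lambda>N. (N (Suc j), N(j := 0))) \<in> chains k j n \<rightarrow> (SIGMA r:{0..n}. chains k (Suc j) r)"
    using assms by (auto simp: chains_def less_Suc_eq)
  show "(case (case x of (r, M) \<Rightarrow> M(j := n)) of N \<Rightarrow> (N (Suc j), N(j := 0))) = x"
    if "x \<in> (SIGMA r:{0..n}. chains k (Suc j) r)" for x
    using that by (auto simp: chains_def fun_eq_iff)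
  show "(case (N (Suc j), N(j := 0)) of (r, M) \<Rightarrow> M(j := n)) = N" if "N \<in> chains k j n" for N
    using that by (simp add: chains_def fun_upd_idem_iff)
qed

lemma finite_chains: "j \<le> k \<Longrightarrow> finite (chains k j n)"
proof (induction j arbitrary: n rule: inc_induct)
  case (step j)
  have "finite (SIGMA r:{0..n}. chains k (Suc j) r)"
    using step.IH by auto
  thus ?case using bij_betw_finite[OF bij_betw_chains[OF step.hyps(2)]] by blast
qed (simp add: chains_self)

lemma card_chains_le: "j \<le> k \<Longrightarrow> card (chains k j (int n)) \<le> Suc n ^ (k - j)"
proof (induction j arbitrary: n rule: inc_induct)
  case (step j)
  have "card (chains k j (int n)) = card (SIGMA r:{0..int n}. chains k (Suc j) r)"
    using bij_betw_same_card[OF bij_betw_chains[OF step.hyps(2)]] by simp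
  also have "\<dots> = (\<Sum>r\<in>{0..int n}. card (chains k (Suc j) r))"
    using step.hyps by (intro card_SigmaI) (auto intro: finite_chains)
  also have "\<dots> \<le> (\<Sum>r\<in>{0..int n}. Suc n ^ (k - Suc j))"
  proof (rule sum_mono)
    fix r assume r: "r \<in> {0..int n}"
    have "card (chains k (Suc j) r) \<le> Suc (nat r) ^ (k - Suc j)"
      using step.IH[of "nat r"] r by simp
    also have "\<dots> \<le> Suc n ^ (k - Suc j)"
      using r by (intro power_mono) auto
    finally show "card (chains k (Suc j) r) \<le> Suc n ^ (k - Suc j)" .
  qed
  also have "\<dots> = Suc n ^ Suc (k - Suc j)" by (simp add: nat_add_distrib)
  also have "Suc (k - Suc j) = k - j" using step.hyps by simp
  finally show ?case .
qed (simp add: chains_self)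

lemma summable_on_chains:
  fixes r :: real
  assumes "j \<le> k" and "0 \<le> r" "r < 1"
  shows "(\<lambda>(n, N). r ^ n) summable_on (SIGMA n:UNIV. chains k j (int n))"
proof (rule summable_on_SigmaI)
  show "((\<lambda>N. case (n, N) of (n, N) \<Rightarrow> r ^ n) has_sum real (card (chains k j (int n))) * r ^ n)
      (chains k j (int n))" for n
    using assms by (intro has_sum_finiteI finite_chains) simp_all
  have "(\<lambda>n. real (Suc n) ^ (k - j) * r ^ n) summable_on UNIV"
    using assms by (intro summable_nonneg_imp_summable_on summable_poly_geometric) auto
  thus "(\<lambda>n. real (card (chains k j (int n))) * r ^ n) summable_on UNIV"
  proof (rule summable_on_comparison_test)
    fix n
    have "real (card (chains k j (int n))) \<le> real (Suc n ^ (k - j))"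
      using card_chains_le[OF assms(1)] by (intro of_nat_mono)
    thus "real (card (chains k j (int n))) * r ^ n \<le> real (Suc n) ^ (k - j) * r ^ n"
      using assms by (intro mult_right_mono) auto
  qed (use assms in auto)
qed (use assms in auto)

lemma chain_sum_self: "chain_sum k \<omega> \<rho> k n = (if n = 0 then \<omega> k 0 else 0)"
  by (simp add: chain_sum_def chain_weight_def chains_self)

lemma chain_sum_rec:
  assumes "j < k"
  shows "chain_sum k \<omega> \<rho> j n = \<omega> j n * (\<Sum>r\<in>{0..n}. \<rho> (n - r) * chain_sum k \<omega> \<rho> (Suc j) r)"
proof -
  have "chain_sum k \<omega> \<rho> j n =
      (\<Sum>(r, M)\<in>(SIGMA r:{0..n}. chains k (Suc j) r). chain_weight k \<omega> \<rho> j (M(j := n)))"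
    unfolding chain_sum_def
    by (subst sum.reindex_bij_betw[OF bij_betw_chains[OF assms], symmetric]) (simp add: case_prod_unfold)
  also have "\<dots> = (\<Sum>(r, M)\<in>(SIGMA r:{0..n}. chains k (Suc j) r).
      \<omega> j n * (\<rho> (n - r) * chain_weight k \<omega> \<rho> (Suc j) M))"
  proof (intro sum.cong refl, clarify)
    fix r M assume "M \<in> chains k (Suc j) r"
    hence "M (Suc j) = r" by (simp add: chains_def)
    thus "chain_weight k \<omega> \<rho> j (M(j := n)) = \<omega> j n * (\<rho> (n - r) * chain_weight k \<omega> \<rho> (Suc j) M)"
      using assms
      by (simp add: chain_weight_def prod.atLeast_Suc_lessThan prod.atLeast_Suc_atMost mult_ac)
  qed
  also have "\<dots> = \<omega> j n * (\<Sum>r\<in>{0..n}. \<rho> (n - r) * chain_sum k \<omega> \<rho> (Suc j) r)"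
    unfolding chain_sum_def sum_distrib_left
    using assms by (subst sum.Sigma) (auto simp: finite_chains)
  finally show ?thesis .
qed

lemma chains_1_iff_tuples:
  assumes "k \<ge> 1"
  shows "N \<in> chains k 1 n \<longleftrightarrow> N \<in> tuples k \<and> N 1 = n"
proof
  assume N: "N \<in> chains k 1 n"
  have "0 \<le> n"
  proof (cases "k = 1")
    case False
    hence "1 \<in> {1..<k}" using assms by simp
    hence "0 \<le> N (Suc 1)" "N (Suc 1) \<le> N 1" "N 1 = n"
      using N unfolding chains_def by blast+
    thus ?thesis by linarith
  qed (use N in \<open>auto simp: chains_def\<close>)
  with N have "0 \<le> N l" for l by (rule chains_nonneg)
  thus "N \<in> tuples k \<and> N 1 = n"
    using N by (auto simp: tuples_def chains_def not_less Suc_le_eq)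
next
  assume N: "N \<in> tuples k \<and> N 1 = n"
  have nonneg: "0 \<le> N l" for l
    using N by (cases "l \<in> {1..<k}") (auto simp: tuples_def)
  have "N (Suc l) \<le> N l" if "l \<in> {1..<k}" for l
  proof (cases "Suc l < k")
    case False
    hence "N (Suc l) = 0" using N by (auto simp: tuples_def)
    thus ?thesis using nonneg by simp
  qed (use N that in \<open>auto simp: tuples_def\<close>)
  with nonneg show "N \<in> chains k 1 n"
    using N by (auto simp: chains_def tuples_def)
qed

lemma bij_betw_chains_tuples:
  assumes "k \<ge> 1"
  shows "bij_betw snd (SIGMA n:UNIV. chains k 1 (int n)) (tuples k)"
proof (rule bij_betwI[of _ _ _ "\<lambda>N. (nat (N 1), N)"])
  have "0 \<le> N 1" if "N \<in> tuples k" for N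
    using that by (cases "k = 1") (auto simp: tuples_def)
  thus "(\<lambda>N. (nat (N 1), N)) \<in> tuples k \<rightarrow> (SIGMA n:UNIV. chains k 1 (int n))"
    using assms by (auto simp: chains_1_iff_tuples simp del: One_nat_def)
qed (use assms in \<open>auto simp: chains_1_iff_tuples simp del: One_nat_def\<close>)

section \<open>Iterating Bailey's lemma\<close>

context q_base
begin

definition chain_alpha :: "nat \<Rightarrow> nat \<Rightarrow> int \<Rightarrow> complex" where
  "chain_alpha m l s = q powi (int l * s\<^sup>2) *
     ((1 + q powi s) * (q powi (int m * (s\<^sup>2 + s)) * theta_term 1 s))"

definition chain_beta :: "nat \<Rightarrow> nat \<Rightarrow> int \<Rightarrow> complex" where
  "chain_beta m l = (bailey_op 0 ^^ l) (\<lambda>n. (1 + q powi n) * (bailey_op 1 ^^ m) unit_seq n)"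

theorem bailey_pair_chain: "bailey_pair 0 (chain_alpha m l) (chain_beta m l)"
proof -
  have "bailey_pair 1 (\<lambda>s. q powi (int m * (s\<^sup>2 + s)) * theta_term 1 s) ((bailey_op 1 ^^ m) unit_seq)"
    using bailey_lemma_iterated[OF unit_bailey_pair, of m] by simp
  hence "bailey_pair 0 (\<lambda>s. (1 + q powi s) * (q powi (int m * (s\<^sup>2 + s)) * theta_term 1 s))
      (\<lambda>n. (1 + q powi n) * (bailey_op 1 ^^ m) unit_seq n)"
  proof (rule bailey_pair_1_imp_0)
    fix s :: int
    have "(- 1 - s)\<^sup>2 + (- 1 - s) = s\<^sup>2 + s"
      by (simp add: power2_eq_square algebra_simps)
    thus "q powi (int m * ((- 1 - s)\<^sup>2 + (- 1 - s))) * theta_term 1 (- 1 - s)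
        = - (q powi (2 * s + 1) * (q powi (int m * (s\<^sup>2 + s)) * theta_term 1 s))"
      by (simp only: theta_term_one_reflect) simp
  qed
  from bailey_lemma_iterated[OF this, of l] show ?thesis
    by (simp add: chain_alpha_def[abs_def] chain_beta_def)
qed

lemma chain_alpha_conv_tri:
  "chain_alpha m l s = (1 + q powi s) *
     ((- 1) powi s * q powi (int (2 * m + 2 * l + 1) * tri s + int (2 * m + l) * s))"
proof -
  have "s\<^sup>2 = 2 * tri s + s"
    using two_tri[of s] by (simp add: power2_eq_square algebra_simps)
  hence "int (2 * m + 2 * l + 1) * tri s + int (2 * m + l) * s = int l * s\<^sup>2 + int m * (s\<^sup>2 + s) + tri s"
    by (simp add: algebra_simps)
  thus ?thesis
    by (simp only: chain_alpha_def theta_term_def powi_add mult_ac)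
qed

lemma chain_alpha_abs_summable: "(\<lambda>s. norm (chain_alpha m l s)) summable_on UNIV"
proof -
  define f where "f b s = q powi (int (2 * m + 2 * l + 1) * tri s + b * s)" for b s
  let ?b = "int (2 * m + l)"
  have "(\<lambda>s. norm (f ?b s) + norm (f (?b + 1) s)) summable_on UNIV"
    unfolding f_def by (intro summable_on_add theta_powers_abs_summable) simp_all
  thus ?thesis
  proof (rule summable_on_comparison_test)
    fix s
    have "f (?b + 1) s = q powi s * f ?b s"
      by (simp add: f_def algebra_simps flip: powi_add)
    hence "chain_alpha m l s = (- 1) powi s * (f ?b s + f (?b + 1) s)"
      unfolding chain_alpha_conv_tri f_def[symmetric] by (simp add: algebra_simps)
    thus "norm (chain_alpha m l s) \<le> norm (f ?b s) + norm (f (?b + 1) s)"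
      by (simp add: norm_mult norm_power_int norm_triangle_ineq)
  qed simp
qed

definition vertex_weight :: "nat \<Rightarrow> nat \<Rightarrow> int \<Rightarrow> complex" where
  "vertex_weight i l a =
     q powi (a\<^sup>2 + (if i < l then a else 0)) * (if l = i then 1 + q powi a else 1)"

lemma norm_vertex_weight_le:
  assumes "0 \<le> a"
  shows "norm (vertex_weight i l a) \<le> 2"
proof -
  have "norm (1 + q powi a) \<le> 2"
    using norm_triangle_ineq[of 1 "q powi a"] norm_powi_le_1[OF assms] by simp
  hence "norm (vertex_weight i l a) \<le> 1 * 2"
    unfolding vertex_weight_def norm_mult using assms
    by (intro mult_mono norm_powi_le_1) auto
  thus ?thesis by simp
qed

lemma chain_sum_above:
  assumes "i < j" and "j \<le> k"
  shows "chain_sum k (vertex_weight i) rqfac j n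
    = q powi (n\<^sup>2 + n) * (bailey_op 1 ^^ (k - j)) unit_seq n"
  using assms(2,1)
proof (induction j arbitrary: n rule: inc_induct)
  case base
  thus ?case by (simp add: chain_sum_self vertex_weight_def unit_seq_def)
next
  case (step j)
  have "vertex_weight i j n = q powi (n\<^sup>2 + n)"
    using step.prems by (simp add: vertex_weight_def)
  moreover have "k - j = Suc (k - Suc j)" using step.hyps by simp
  ultimately show ?case
    using step by (simp add: chain_sum_rec bailey_op_def mult.assoc)
qed

lemma chain_sum_below:
  assumes "j \<le> i" and "i \<le> k"
  shows "chain_sum k (vertex_weight i) rqfac j n
    = q powi (n\<^sup>2) * chain_beta (k - i) (i - j) n"
  using assms(1)
proof (induction j arbitrary: n rule: inc_induct)
  case base
  show ?case
  proof (cases "i = k")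
    case True
    thus ?thesis by (simp add: chain_sum_self vertex_weight_def unit_seq_def chain_beta_def)
  next
    case False
    hence "chain_sum k (vertex_weight i) rqfac i n = q powi (n\<^sup>2) * (1 + q powi n) *
        bailey_op 1 ((bailey_op 1 ^^ (k - Suc i)) unit_seq) n"
      using assms(2)
      by (simp add: chain_sum_rec chain_sum_above vertex_weight_def bailey_op_def mult.assoc)
    moreover have "k - i = Suc (k - Suc i)" using False assms(2) by simp
    ultimately show ?thesis by (simp add: chain_beta_def)
  qed
next
  case (step j)
  have "vertex_weight i j n = q powi (n\<^sup>2)"
    using step.hyps by (simp add: vertex_weight_def)
  moreover have "i - j = Suc (i - Suc j)" using step.hyps by simp
  ultimately show ?case
    using step assms(2) by (simp add: chain_sum_rec chain_beta_def bailey_op_def mult.assoc)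
qed

end

section \<open>The multiple sum\<close>

locale q_base_square = q_base p for p :: complex +
  fixes q :: complex
  assumes p_eq: "p = q\<^sup>2"
begin

sublocale root: q_base q
proof
  show "q \<noteq> 0" using q_nonzero p_eq by auto
  show "norm q < 1"
    using norm_q_less_1 by (simp add: p_eq norm_power power_less_one_iff)
qed

lemma p_powi: "p powi s = q powi (2 * s)"
  by (simp add: p_eq power_int_mult)

lemma qpoch_inf_minus_one: "qpoch_inf (- 1) p = 2 * qpoch_inf (- p) p"
  using qpoch_inf_split[OF norm_q_less_1, of "- 1" 1] by (simp add: qpochhammer_Suc)

lemma qpoch_inf_even_odd_root: "qpoch_inf (x * q) p * qpoch_inf x p = qpoch_inf x q"
  using qpoch_inf_even_odd[OF root.norm_q_less_1, of x] by (simp add: p_eq mult.commute)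

definition outer_weight :: "nat \<Rightarrow> complex" where
  "outer_weight n = qpochhammer (- 1) p n * qpochhammer (- q) p n * q ^ n / 2"

lemma outer_weight_bounded:
  obtains C where "C > 0" and "\<And>n. norm (outer_weight n) \<le> C * norm q ^ n"
proof -
  have "(\<lambda>n. qpochhammer (- 1) p n * qpochhammer (- q) p n / 2)
      \<longlonglongrightarrow> qpoch_inf (- 1) p * qpoch_inf (- q) p / 2"
    by (intro tendsto_intros qpochhammer_tendsto norm_q_less_1) simp
  then obtain C where C: "C > 0" "\<And>n. norm (qpochhammer (- 1) p n * qpochhammer (- q) p n / 2) \<le> C"
    using tendsto_imp_norm_bounded by blast
  show thesis
  proof (rule that)
    fix n
    have "norm (outer_weight n) = norm (qpochhammer (- 1) p n * qpochhammer (- q) p n / 2) * norm q ^ n"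
      by (simp add: outer_weight_def norm_mult norm_divide norm_power)
    also have "\<dots> \<le> C * norm q ^ n"
      by (intro mult_right_mono C) simp
    finally show "norm (outer_weight n) \<le> C * norm q ^ n" .
  qed (rule C)
qed

lemma outer_weight_abs_summable: "(\<lambda>n. norm (outer_weight n)) summable_on UNIV"
proof -
  obtain C where C: "C > 0" "\<And>n. norm (outer_weight n) \<le> C * norm q ^ n"
    using outer_weight_bounded by blast
  have "(\<lambda>n. C * norm q ^ n) summable_on UNIV"
    using C(1) root.norm_q_less_1
    by (intro summable_on_cmult_right summable_nonneg_imp_summable_on summable_geometric) auto
  thus ?thesis
    by (rule summable_on_comparison_test) (use C in auto)
qed

lemma outer_weight_conv_qpoch:
  "outer_weight n = qpoch (- (q powi (2 - 2 * int n))) p (int n - 1) *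
     qpoch (- (q powi (1 - 2 * int n))) p (int n) * p powi ((int n)\<^sup>2)"
proof -
  define x where "x = p powi (1 - int n) / - 1"
  define y where "y = p powi (1 - int n) / - q"
  have x_eq: "x = - (q powi (2 - 2 * int n))"
    by (simp add: x_def p_powi algebra_simps)
  have y_eq: "y = - (q powi (1 - 2 * int n))"
    by (simp add: y_def p_powi power_int_diff field_simps power2_eq_square)
  have p_small: "norm (- p) < 1" and q_small: "norm (- q) < 1"
    using norm_q_less_1 root.norm_q_less_1 by simp_all
  have "x * p powi (int n - 1) = - 1"
    by (simp add: x_def flip: powi_add)
  moreover have "x * p ^ n = - p"
    by (simp add: x_def power_int_diff)
  ultimately have "qpoch x p (int n - 1) = qpochhammer x p n / 2"
    using qpoch_inf_split[OF norm_q_less_1, of x n] qpoch_inf_nonzero[OF norm_q_less_1 p_small]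
    by (simp add: qpoch_def qpoch_inf_minus_one)
  moreover have "y * p ^ n = - q"
    by (simp add: y_def power_int_diff p_eq power2_eq_square)
  hence "qpoch y p (int n) = qpochhammer y p n"
    using qpoch_inf_nonzero[OF norm_q_less_1 q_small] by (intro qpoch_of_nat norm_q_less_1) simp
  moreover have "qpochhammer (- 1) p n * qpochhammer (- q) p n * q ^ n
      = qpochhammer x p n * qpochhammer y p n * p powi ((int n)\<^sup>2)"
  proof -
    have "tri (int n) + tri (int n) + int n = (int n)\<^sup>2"
      using two_tri[of "int n"] by (simp add: power2_eq_square algebra_simps)
    hence "p powi ((int n)\<^sup>2) = p powi tri (int n) * p powi tri (int n) * p ^ n"
      by (metis powi_add power_int_of_nat)
    moreover have "p ^ n = q ^ n * q ^ n"
      by (simp add: p_eq power2_eq_square power_mult_distrib)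
    moreover have "qpochhammer (- 1) p n = p powi tri (int n) * qpochhammer x p n"
      using qpochhammer_reverse[of "- 1" p n] by (simp add: x_def)
    moreover have "qpochhammer (- q) p n = q ^ n * p powi tri (int n) * qpochhammer y p n"
      using qpochhammer_reverse[of "- q" p n] by (simp add: y_def)
    ultimately show ?thesis by simp
  qed
  ultimately show ?thesis
    unfolding x_eq[symmetric] y_eq[symmetric] by (simp add: outer_weight_def)
qed

lemma outer_weight_kernel_shift:
  "outer_weight (m + t) * bailey_kernel 0 (int (m + t)) (int t) =
     outer_weight t * rqfac (int (2 * t)) *
     (qpochhammer (- (p ^ t)) p m * qpochhammer (- q * p ^ t) p m / qpochhammer (p * p ^ (2 * t)) p m *
      rqfac (int m) * q ^ m)"
proof -
  have "qpochhammer (- 1) p (m + t) = qpochhammer (- 1) p t * qpochhammer (- (p ^ t)) p m"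
    and "qpochhammer (- q) p (m + t) = qpochhammer (- q) p t * qpochhammer (- q * p ^ t) p m"
    unfolding add.commute[of m] qpochhammer_add by simp_all
  moreover have "rqfac (int (2 * t + m)) = rqfac (int (2 * t)) / qpochhammer (p * p ^ (2 * t)) p m"
    unfolding rqfac_of_nat qpochhammer_add by (simp add: inverse_eq_divide)
  moreover have "bailey_kernel 0 (int (m + t)) (int t) = rqfac (int m) * rqfac (int (2 * t + m))"
    by (simp add: bailey_kernel_def algebra_simps)
  ultimately show ?thesis
    by (simp add: outer_weight_def power_add mult_ac)
qed

lemma outer_weight_gauss_value:
  "outer_weight t * rqfac (int (2 * t)) *
     (qpoch_inf (- q * p ^ t) p * qpoch_inf (- p * p ^ t) p /
      (qpoch_inf (p * p ^ (2 * t)) p * qpoch_inf q p))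
   = qpoch_inf (- q) q / qpoch_inf q q * (q ^ t / (1 + p ^ t))"
proof -
  let ?P = "\<lambda>x. qpoch_inf x p"
  have "1 + p ^ t \<noteq> 0"
    using one_plus_powi_nonzero[of "int t"] by simp
  hence "outer_weight t * rqfac (int (2 * t)) *
     (?P (- q * p ^ t) * ?P (- p * p ^ t) / (?P (p * p ^ (2 * t)) * ?P q))
     = (qpochhammer (- 1) p t * ((1 + p ^ t) * ?P (- p * p ^ t)) / 2) *
       (qpochhammer (- q) p t * ?P (- q * p ^ t)) /
       (qpochhammer p p (2 * t) * ?P (p * p ^ (2 * t)) * ?P q) * (q ^ t / (1 + p ^ t))"
    unfolding outer_weight_def rqfac_of_nat by (simp add: inverse_eq_divide mult_ac)
  also have "qpochhammer (- 1) p t * ((1 + p ^ t) * ?P (- p * p ^ t)) / 2 = ?P (- p)"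
    using qpoch_inf_split[OF norm_q_less_1, of "- 1" t] qpoch_inf_split[OF norm_q_less_1, of "- (p ^ t)" 1]
    by (simp add: qpoch_inf_minus_one qpochhammer_Suc mult.commute)
  also have "qpochhammer (- q) p t * ?P (- q * p ^ t) = ?P (- q)"
    by (rule qpoch_inf_split[OF norm_q_less_1, symmetric])
  also have "qpochhammer p p (2 * t) * ?P (p * p ^ (2 * t)) = ?P p"
    by (rule qpoch_inf_split[OF norm_q_less_1, symmetric])
  also have "?P (- p) * ?P (- q) = qpoch_inf (- q) q"
    using qpoch_inf_even_odd_root[of "- q"] by (simp add: p_eq power2_eq_square)
  also have "?P p * ?P q = qpoch_inf q q"
    using qpoch_inf_even_odd_root[of q] by (simp add: p_eq power2_eq_square)
  finally show ?thesis .
qed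

lemma outer_weight_kernel_has_sum_of_nat:
  "((\<lambda>n. outer_weight n * bailey_kernel 0 (int n) (int t)) has_sum
     qpoch_inf (- q) q / qpoch_inf q q * (q ^ t / (1 + p ^ t))) UNIV"
proof -
  have denominator_eq: "- (p ^ t) * (- q * p ^ t) * q = p * p ^ (2 * t)"
    and numerator_eq: "- q * p ^ t * q = - p * p ^ t"
    by (simp_all add: p_eq power2_eq_square mult_2 power_add)
  have "norm (- q * p ^ t) < 1"
    using root.norm_q_less_1 by (intro norm_mult_power_less_1 norm_q_less_1) simp
  moreover have "qpoch_inf (p * p ^ (2 * t)) p \<noteq> 0"
    by (intro qpoch_inf_nonzero norm_mult_power_less_1 norm_q_less_1)
  ultimately have "((\<lambda>m. qpochhammer (- (p ^ t)) p m * qpochhammer (- q * p ^ t) p m /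
        qpochhammer (p * p ^ (2 * t)) p m * rqfac (int m) * q ^ m) has_sum
      qpoch_inf (- (p ^ t) * q) p * qpoch_inf (- p * p ^ t) p /
        (qpoch_inf (p * p ^ (2 * t)) p * qpoch_inf q p)) UNIV"
    using q_gauss_sum[of "- q * p ^ t" q "- (p ^ t)"] root.norm_q_less_1
    unfolding numerator_eq denominator_eq by simp
  from has_sum_cmult_right[OF this, of "outer_weight t * rqfac (int (2 * t))"]
  have "((\<lambda>m. outer_weight (m + t) * bailey_kernel 0 (int (m + t)) (int t)) has_sum
      qpoch_inf (- q) q / qpoch_inf q q * (q ^ t / (1 + p ^ t))) UNIV"
    unfolding outer_weight_kernel_shift outer_weight_gauss_value[symmetric] by (simp add: mult.commute)
  also have "?this \<longleftrightarrow> ((\<lambda>n. outer_weight n * bailey_kernel 0 (int n) (int t)) has_sum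
      qpoch_inf (- q) q / qpoch_inf q q * (q ^ t / (1 + p ^ t))) {t..}"
    by (rule has_sum_reindex_bij_witness[of _ "\<lambda>n. n - t" "\<lambda>m. m + t"]) auto
  also have "\<dots> \<longleftrightarrow> ?thesis"
    by (rule has_sum_cong_neutral) (auto simp: bailey_kernel_eq_0)
  finally show ?thesis .
qed

lemma outer_weight_kernel_has_sum:
  "((\<lambda>n. outer_weight n * bailey_kernel 0 (int n) s) has_sum
     qpoch_inf (- q) q / qpoch_inf q q * (q powi s / (1 + p powi s))) UNIV"
proof (cases "s \<ge> 0")
  case True
  thus ?thesis using outer_weight_kernel_has_sum_of_nat[of "nat s"] by (simp flip: power_int_of_nat)
next
  case False
  have "q powi (- s) / (1 + p powi (- s)) = q powi s / (1 + p powi s)"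
  proof -
    have "q powi (- s) * (1 + p powi s) = q powi s * (1 + p powi (- s))"
      unfolding p_powi by (simp add: distrib_left flip: root.powi_add)
    thus ?thesis using one_plus_powi_nonzero by (simp add: frac_eq_eq)
  qed
  thus ?thesis
    using outer_weight_kernel_has_sum_of_nat[of "nat (- s)"] False bailey_kernel_reflect[of 0 _ s]
    by (simp flip: power_int_of_nat)
qed

lemma chain_alpha_theta_sum:
  assumes "1 \<le> i" "i \<le> k"
  shows "((\<lambda>s. chain_alpha (k - i) (i - 1) s * (q powi s / (1 + p powi s))) has_sum
    qpochs_inf [q ^ (2 * i - 1), q ^ (4 * k - 1 - 2 * i), q ^ (4 * k - 2)] (q ^ (4 * k - 2))) UNIV"
proof -
  define b where "b = 4 * k - 1 - 2 * i"
  define M where "M = 4 * k - 2"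
  have "chain_alpha (k - i) (i - 1) s * (q powi s / (1 + p powi s))
      = (- 1) powi s * q powi (int M * tri s + int b * s)" for s
  proof -
    have "int M * tri s + int b * s =
        2 * (int (2 * (k - i) + 2 * (i - 1) + 1) * tri s + int (2 * (k - i) + (i - 1)) * s) + s"
      using assms by (simp add: M_def b_def algebra_simps)
    hence "q powi (int M * tri s + int b * s) =
        p powi (int (2 * (k - i) + 2 * (i - 1) + 1) * tri s + int (2 * (k - i) + (i - 1)) * s) * q powi s"
      by (simp only: p_powi root.powi_add)
    thus ?thesis
      using one_plus_powi_nonzero[of s] by (simp add: chain_alpha_conv_tri)
  qed
  moreover have "((\<lambda>s. (- 1) powi s * q powi (int M * tri s + int b * s)) has_sum
      qpochs_inf [q ^ (2 * i - 1), q ^ b, q ^ M] (q ^ M)) UNIV"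
  proof -
    have "M = (2 * i - 1) + b" using assms by (simp add: M_def b_def)
    hence "q ^ M / q powi int b = q ^ (2 * i - 1)"
      by (simp add: power_add)
    moreover have "M > 0" using assms by (simp add: M_def)
    ultimately show ?thesis
      using root.jacobi_triple_product_powers[of M "int b"] by (simp add: qpochs_inf_def mult_ac)
  qed
  ultimately show ?thesis
    by (simp add: M_def b_def)
qed

lemma prod_vertex_weight:
  assumes "1 \<le> i" "i \<le> k" and "N k = 0"
  shows "(\<Prod>l\<in>{1..k}. vertex_weight i l (N l)) =
    q powi (2 * ((\<Sum>l\<in>{1..<k}. (N l)\<^sup>2) + (\<Sum>l\<in>{i+1..<k}. N l))) * (1 + q powi (2 * N i))"
proof -
  have "{1..k} = insert k {1..<k}" using assms by auto
  hence "(\<Sum>l\<in>{1..k}. (N l)\<^sup>2 + (if i < l then N l else 0))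
      = (\<Sum>l\<in>{1..<k}. (N l)\<^sup>2) + (\<Sum>l\<in>{1..<k}. if i < l then N l else 0)"
    using assms by (simp add: sum.distrib)
  also have "(\<Sum>l\<in>{1..<k}. if i < l then N l else 0) = (\<Sum>l\<in>{i+1..<k}. N l)"
    by (rule sum.mono_neutral_cong_right) auto
  finally have "(\<Prod>l\<in>{1..k}. p powi ((N l)\<^sup>2 + (if i < l then N l else 0)))
      = p powi ((\<Sum>l\<in>{1..<k}. (N l)\<^sup>2) + (\<Sum>l\<in>{i+1..<k}. N l))"
    by (simp only: powi_sum[symmetric] finite_atLeastAtMost)
  moreover have "(\<Prod>l\<in>{1..k}. if l = i then 1 + p powi N l else 1) = 1 + p powi N i"
    using assms by (subst prod.delta) auto
  ultimately show ?thesis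
    by (simp only: vertex_weight_def prod.distrib p_powi)
qed

lemma prod_rqfac_differences:
  assumes "1 \<le> k" and N: "N \<in> chains k 1 n"
  shows "(\<Prod>l\<in>{1..<k}. rqfac (N l - N (Suc l))) =
    inverse ((\<Prod>l\<in>{1..<k - 1}. qpoch p p (N l - N (l + 1))) * qpoch p p (N (k - 1)))"
proof (cases "k = 1")
  case True
  hence "N 0 = 0" using N by (simp add: chains_def)
  thus ?thesis using True qpoch_q_q[of 0] by simp
next
  case False
  hence last_index: "k - 1 \<in> {1..<k}" "Suc (k - 1) = k"
    and split: "{1..<k} = insert (k - 1) {1..<k - 1}"
    using assms by auto
  have "N k = 0" and mono: "\<And>l. l \<in> {1..<k} \<Longrightarrow> 0 \<le> N (Suc l) \<and> N (Suc l) \<le> N l"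
    using N by (auto simp: chains_def)
  hence "(\<Prod>l\<in>{1..<k}. rqfac (N l - N (Suc l)))
      = rqfac (N (k - 1)) * (\<Prod>l\<in>{1..<k - 1}. rqfac (N l - N (Suc l)))"
    unfolding split by (simp add: last_index del: One_nat_def)
  also have "rqfac (N (k - 1)) = inverse (qpoch p p (N (k - 1)))"
    using mono[OF last_index(1)] last_index(2) \<open>N k = 0\<close> by (simp add: qpoch_q_q)
  also have "(\<Prod>l\<in>{1..<k - 1}. rqfac (N l - N (Suc l)))
      = (\<Prod>l\<in>{1..<k - 1}. inverse (qpoch p p (N l - N (l + 1))))"
    using mono by (intro prod.cong) (auto simp: qpoch_q_q)
  finally show ?thesis
    by (simp add: prod_inversef[symmetric] o_def)
qed

lemma summand_conv_chain_weight:
  assumes "1 \<le> i" "i \<le> k" and N: "N \<in> chains k 1 (int n)"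
  shows "p powi ((int n)\<^sup>2) * summand k i q N
    = outer_weight n * chain_weight k (vertex_weight i) rqfac 1 N"
proof -
  have "N 1 = int n" "N k = 0" using N by (auto simp: chains_def)
  moreover have "1 \<le> k" using assms by simp
  ultimately show ?thesis
    unfolding summand_def chain_weight_def outer_weight_conv_qpoch prod_rqfac_differences[OF \<open>1 \<le> k\<close> N]
      prod_vertex_weight[of i k N, OF assms(1,2) \<open>N k = 0\<close>] p_eq[symmetric]
    by (simp add: divide_inverse mult_ac)
qed

lemma sum_summand_chains:
  assumes "1 \<le> i" "i \<le> k"
  shows "(\<Sum>N\<in>chains k 1 (int n). summand k i q N)
    = outer_weight n * chain_beta (k - i) (i - 1) (int n)"
proof -
  have "p powi ((int n)\<^sup>2) * (\<Sum>N\<in>chains k 1 (int n). summand k i q N)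
      = outer_weight n * chain_sum k (vertex_weight i) rqfac 1 (int n)"
    unfolding chain_sum_def sum_distrib_left
    by (intro sum.cong refl summand_conv_chain_weight assms)
  thus ?thesis
    using assms by (simp add: chain_sum_below)
qed

lemma norm_summand_le:
  assumes "1 \<le> i" "i \<le> k"
  obtains C where "\<And>n N. N \<in> chains k 1 (int n) \<Longrightarrow> norm (summand k i q N) \<le> C * norm q ^ n"
proof -
  obtain R where R: "R \<ge> 1" "\<And>n. norm (rqfac n) \<le> R" using rqfac_bounded by blast
  obtain W where W: "W > 0" "\<And>n. norm (outer_weight n) \<le> W * norm q ^ n"
    using outer_weight_bounded by blast
  show thesis
  proof (rule that)
    fix n N assume N: "N \<in> chains k 1 (int n)"
    let ?first = "if i = 1 then 1 + p powi int n else 1"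
    let ?vertices = "\<Prod>l\<in>{Suc 1..k}. vertex_weight i l (N l)"
    let ?edges = "\<Prod>l\<in>{1..<k}. rqfac (N l - N (Suc l))"
    have "N 1 = int n" using N by (simp add: chains_def)
    moreover have "(\<Prod>l\<in>{1..k}. vertex_weight i l (N l)) = vertex_weight i 1 (N 1) * ?vertices"
      using assms by (intro prod.atLeast_Suc_atMost) simp
    ultimately have "chain_weight k (vertex_weight i) rqfac 1 N
        = p powi ((int n)\<^sup>2) * (?first * ?vertices * ?edges)"
      using assms by (simp add: chain_weight_def vertex_weight_def mult_ac)
    hence "summand k i q N = outer_weight n * (?first * ?vertices * ?edges)"
      using summand_conv_chain_weight[OF assms N] by simp
    moreover have "norm ?first \<le> 2"
      using norm_triangle_ineq[of 1 "p powi int n"] norm_powi_le_1[of "int n"] by auto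
    moreover have "norm ?vertices \<le> 2 ^ k"
      unfolding prod_norm[symmetric] using chains_nonneg[OF N]
      by (intro prod_le_power) (auto intro: norm_vertex_weight_le)
    moreover have "norm ?edges \<le> R ^ k"
      unfolding prod_norm[symmetric] using R by (intro prod_le_power) auto
    ultimately have "norm (summand k i q N) \<le> W * norm q ^ n * (2 * 2 ^ k * R ^ k)"
      unfolding norm_mult using W R by (simp only: norm_mult) (intro mult_mono, auto)
    thus "norm (summand k i q N) \<le> W * (2 * 2 ^ k * R ^ k) * norm q ^ n"
      by (simp add: mult_ac)
  qed
qed

lemma summand_summable_on_chains:
  assumes "1 \<le> i" "i \<le> k"
  shows "(\<lambda>(n, N). summand k i q N) summable_on (SIGMA n:UNIV. chains k 1 (int n))"
proof -
  obtain C where C: "\<And>n N. N \<in> chains k 1 (int n) \<Longrightarrow> norm (summand k i q N) \<le> C * norm q ^ n"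
    using norm_summand_le[OF assms] by blast
  have "(\<lambda>(n, N). norm q ^ n) summable_on (SIGMA n:UNIV. chains k 1 (int n))"
    using assms root.norm_q_less_1 by (intro summable_on_chains) auto
  hence "(\<lambda>x. C * (case x of (n, N) \<Rightarrow> norm q ^ n))
      summable_on (SIGMA n:UNIV. chains k 1 (int n))"
    by (rule summable_on_cmult_right)
  thus ?thesis
    by (rule summable_on_dominated) (use C in auto)
qed

lemma summand_has_sum:
  assumes "1 \<le> i" "i \<le> k"
    and "((\<lambda>n. outer_weight n * chain_beta (k - i) (i - 1) (int n)) has_sum S) UNIV"
  shows "(summand k i q has_sum S) (tuples k)"
proof -
  have "((\<lambda>(n, N). summand k i q N) has_sum S) (SIGMA n:UNIV. chains k 1 (int n))"
  proof (rule has_sum_SigmaI[OF _ assms(3) summand_summable_on_chains[OF assms(1,2)]])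
    show "((\<lambda>N. case (n, N) of (n, N) \<Rightarrow> summand k i q N) has_sum
        outer_weight n * chain_beta (k - i) (i - 1) (int n)) (chains k 1 (int n))" for n
      using assms sum_summand_chains[OF assms(1,2)]
      by (intro has_sum_finiteI finite_chains) auto
  qed
  thus ?thesis
    using has_sum_reindex_bij_betw[OF bij_betw_chains_tuples, of k "summand k i q"] assms
    by (simp add: case_prod_unfold)
qed

end

theorem theorem1p8:
  fixes k i :: nat and q :: complex
  assumes "1 \<le> i" and "i \<le> k"
    and "q \<noteq> 0" and "norm q < 1"
  shows "(summand k i q has_sum
           (qpoch_inf (- q) q *
            qpochs_inf [q ^ (2 * i - 1), q ^ (4 * k - 1 - 2 * i), q ^ (4 * k - 2)] (q ^ (4 * k - 2)) /
            qpoch_inf q q))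
         (tuples k)"
proof -
  interpret q_base_square "q\<^sup>2" q
    using assms by unfold_locales (auto simp: norm_power power_less_one_iff)
  let ?K = "qpoch_inf (- q) q / qpoch_inf q q"
    and ?\<Theta> = "qpochs_inf [q ^ (2 * i - 1), q ^ (4 * k - 1 - 2 * i), q ^ (4 * k - 2)] (q ^ (4 * k - 2))"
  have "((\<lambda>s. chain_alpha (k - i) (i - 1) s * (?K * (q powi s / (1 + (q\<^sup>2) powi s))))
      has_sum ?K * ?\<Theta>) UNIV"
    using has_sum_cmult_right[OF chain_alpha_theta_sum[OF assms(1,2)], of ?K]
    by (simp only: mult.left_commute)
  hence "((\<lambda>n. outer_weight n * chain_beta (k - i) (i - 1) (int n)) has_sum ?K * ?\<Theta>) UNIV"
    by (rule bailey_transform[OF bailey_pair_chain chain_alpha_abs_summable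
          outer_weight_abs_summable outer_weight_kernel_has_sum])
  hence "(summand k i q has_sum ?K * ?\<Theta>) (tuples k)"
    by (rule summand_has_sum[OF assms(1,2)])
  thus ?thesis by simp
qed

end
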